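(* Let $G$ be a finite simple graph with $m \geq 1$ edges, let $c \geq 2$ be an integer, and suppose each vertex of $G$ is colored independently and uniformly at random with one of $c$ colors. Let $Y$ be the number of monochromatic edges of $G$, and let $$W=\frac{Y-\frac{m}{c}}{\sqrt{\frac{m}{c}\left(1-\frac{1}{c}\right)}}.$$ Then $$d_{W}(\mathcal{L}(W), N(0,1))\leq \frac{3}{2}\sqrt{\frac{c}{m}}+\frac{5\sqrt{2}}{\sqrt{c}}+\frac{1}{\sqrt{\pi}}\,\frac{2^{7/4}}{m^{1/4}},$$ where $d_W$ denotes the Wasserstein distance and $N(0,1)$ the standard normal distribution.
   Context: A simple graph is an undirected graph with no loops and no multiple edges. An edge is monochromatic if its two endpoints receive the same color. $\mathcal{L}(W)$ denotes the distribution (law) of $W$. The Wasserstein distance is $$d_W(\mathcal{L}(W), N(0,1)) = \sup_{\|h'\|\leq 1} |\mathbb{E}\, h(W)-\mathbb{E}\, h(Z)|,$$ where $Z$ is a standard normal random variable and the supremum is over functions $h:\mathbb{R}\to\mathbb{R}$ that are Lipschitz with constant at most $1$. *)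

theory Defs
  imports "HOL-Probability.Probability" "HOL-Library.Ramsey"
begin

definition fin_simple_graph :: "'v set \<Rightarrow> 'v set set \<Rightarrow> bool" where
  "fin_simple_graph V E \<longleftrightarrow> finite V \<and> E \<subseteq> nsets V 2"

definition mono_edges :: "'v set set \<Rightarrow> ('v \<Rightarrow> 'k) \<Rightarrow> 'v set set" where
  "mono_edges E f = {e \<in> E. \<forall>u\<in>e. \<forall>v\<in>e. f u = f v}"

text \<open>
  The supremum is taken in the extended reals, where it always exists; in the reals an
  unbounded family would have an unspecified supremum.  The Bochner integral of a
  non-integrable function is \<open>0\<close>, so the definition is meaningful for probability measures
  on the Borel sets with finite first moment: every Lipschitz function is then integrable.
\<close>

definition wasserstein_dist :: "real measure \<Rightarrow> real measure \<Rightarrow> ereal" where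
  "wasserstein_dist \<mu> \<nu> =
     (SUP h \<in> {h :: real \<Rightarrow> real. 1-lipschitz_on UNIV h}.
        ereal \<bar>(\<integral>x. h x \<partial>\<mu>) - (\<integral>x. h x \<partial>\<nu>)\<bar>)"

end

theory Submission
  imports Defs
begin

text \<open>
  Stein's method. Write \<open>p = 1 / c\<close>, let \<open>\<eta> e\<close> be the indicator that \<open>e\<close> is monochromatic minus \<open>p\<close>, and
  \<open>W = (\<Sum>e. \<eta> e) / \<sigma>\<close>. Given all colours except that of one endpoint of \<open>e\<close>, the conditional mean of \<open>\<eta> e\<close>
  is \<open>0\<close>. For every edge take the endpoint \<open>v\<close> of smaller degree (its anchor); deleting the edges at \<open>v\<close>
  changes \<open>W\<close> to \<open>W - D\<close>, which does not depend on the colour of \<open>v\<close>, so \<open>\<eta> e\<close> is uncorrelated with every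
  function of \<open>W - D\<close>. Hence \<open>E (\<eta> e * f W) = E (\<eta> e * (f W - f (W - D) - k * f' (W - D)))\<close> for every \<open>k\<close>, and
  two Taylor expansions around the intermediate point \<open>W - D + k\<close> replace the bracket by \<open>(D - k) * f' W\<close>;
  the choice \<open>k = (1 - 2 p) / (4 \<sigma>)\<close> balances the resulting errors and gives the constant \<open>3 / 2\<close>.
  What remains is the variance of a sum over paths with two edges. Two such paths are correlated only
  if they have the same vertices or form a 4-cycle. The choice of the anchors bounds the number of paths
  by \<open>sqrt 2 * m powr (3 / 2)\<close>; those with the same vertices produce the term of order \<open>m powr (- 1 / 4)\<close>,
  the 4-cycles one of order \<open>1 / sqrt c\<close>.
\<close>

section \<open>Stein's equation for Lipschitz functions\<close>

text \<open>Splitting at \<open>a = w - 1\<close> leaves a part that is constant near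
  \<open>w\<close>, while the fundamental theorem of calculus on \<open>{a..w+1}\<close> handles the
  rest.\<close>

lemma has_real_derivative_set_integral_atMost:
  fixes F :: "real \<Rightarrow> real"
  assumes cont: "continuous_on UNIV F" and int: "integrable lborel F"
  shows "((\<lambda>w. LINT x:{..w}|lborel. F x) has_real_derivative F w) (at w)"
proof -
  have si: "set_integrable lborel A F" if "A \<in> sets borel" for A
    unfolding set_integrable_def using that by (intro integrable_mult_indicator int) auto
  define a where "a = w - 1"
  have eq: "(LINT x:{..u}|lborel. F x) = (LINT x:{..a}|lborel. F x) + integral {a..u} F" if "a < u" for u
  proof -
    have "{..u} = {..a} \<union> {a<..u}" using that by auto
    then have "(LINT x:{..u}|lborel. F x) = (LINT x:{..a}|lborel. F x) + (LINT x:{a<..u}|lborel. F x)"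
      by (simp only:) (rule set_integral_Un, auto intro: si)
    also have "(LINT x:{a<..u}|lborel. F x) = integral {a<..u} F"
      by (intro set_borel_integral_eq_integral si) auto
    also have "\<dots> = integral {a..u} F"
      by (rule integral_spike_set)
        (auto intro: negligible_subset[of "{a}"] simp: not_le)
    finally show ?thesis .
  qed
  have "((\<lambda>u. integral {a..u} F) has_real_derivative F w) (at w within {a..w+1})"
    by (rule integral_has_real_derivative) (auto simp: a_def intro: continuous_on_subset[OF cont])
  then have "((\<lambda>u. integral {a..u} F) has_real_derivative F w) (at w)"
    by (subst (asm) at_within_interior) (auto simp: a_def)
  then have "((\<lambda>u. (LINT x:{..a}|lborel. F x) + integral {a..u} F) has_real_derivative F w) (at w)"
    by (auto intro!: derivative_eq_intros)
  then show ?thesis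
    by (rule has_field_derivative_transform_within_open[of _ _ _ "{a<..}"])
      (auto simp: eq a_def)
qed

section \<open>Gaussian integrals over half-lines\<close>

definition gauss_below :: "(real \<Rightarrow> real) \<Rightarrow> real \<Rightarrow> real" where
  "gauss_below h w = (LINT x:{..w}|lborel. std_normal_density x * h x)"

definition gauss_mean :: "(real \<Rightarrow> real) \<Rightarrow> real" where
  "gauss_mean h = (LINT x|lborel. std_normal_density x * h x)"

abbreviation "normal_cdf \<equiv> gauss_below (\<lambda>_. 1)"

lemma DERIV_std_normal_density [derivative_intros]:
  "(f has_real_derivative f') (at x) \<Longrightarrow>
    ((\<lambda>x. std_normal_density (f x)) has_real_derivative - f x * std_normal_density (f x) * f') (at x)"
  unfolding std_normal_density_def
  by (auto intro!: derivative_eq_intros simp: field_simps)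

lemma continuous_std_normal_density: "continuous_on UNIV std_normal_density"
  by (intro continuous_at_imp_continuous_on ballI DERIV_isCont) (rule DERIV_std_normal_density, rule DERIV_ident)

lemma lipschitz_continuous_real: "1-lipschitz_on UNIV (h::real\<Rightarrow>real) \<Longrightarrow> continuous_on UNIV h"
  by (rule lipschitz_on_continuous_on)

lemma lipschitz_abs_diff: "1-lipschitz_on UNIV (h::real\<Rightarrow>real) \<Longrightarrow> \<bar>h x - h y\<bar> \<le> \<bar>x - y\<bar>"
  by (drule lipschitz_onD[of _ _ _ x y]) (auto simp: dist_real_def)

lemma integrable_gauss_lipschitz:
  fixes h :: "real \<Rightarrow> real"
  assumes "1-lipschitz_on UNIV h"
  shows "integrable lborel (\<lambda>x. std_normal_density x * h x)"
proof (rule Bochner_Integration.integrable_bound)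
  show "integrable lborel (\<lambda>x. \<bar>h 0\<bar> * (std_normal_density x * \<bar>x\<bar>^0) + std_normal_density x * \<bar>x\<bar>^1)"
    by (intro Bochner_Integration.integrable_add integrable_mult_right integrable_std_normal_moment_abs)
  have "h \<in> borel_measurable borel"
    using lipschitz_continuous_real[OF assms] by (rule borel_measurable_continuous_onI)
  then show "(\<lambda>x. std_normal_density x * h x) \<in> borel_measurable lborel" by auto
  have "norm (std_normal_density x * h x) \<le> norm (\<bar>h 0\<bar> * (std_normal_density x * \<bar>x\<bar>^0) + std_normal_density x * \<bar>x\<bar>^1)" for x
  proof -
    have "\<bar>h x\<bar> \<le> \<bar>h 0\<bar> + \<bar>x\<bar>" using lipschitz_abs_diff[OF assms, of x 0] by auto
    then have "std_normal_density x * \<bar>h x\<bar> \<le> std_normal_density x * (\<bar>h 0\<bar> + \<bar>x\<bar>)"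
      by (rule mult_left_mono) simp
    then show ?thesis by (simp add: abs_mult algebra_simps)
  qed
  then show "AE x in lborel. norm (std_normal_density x * h x) \<le> norm (\<bar>h 0\<bar> * (std_normal_density x * \<bar>x\<bar>^0) + std_normal_density x * \<bar>x\<bar>^1)"
    by auto
qed

lemma set_integrable_gauss_lipschitz:
  fixes h :: "real \<Rightarrow> real"
  assumes "1-lipschitz_on UNIV h" "A \<in> sets borel"
  shows "set_integrable lborel A (\<lambda>x. std_normal_density x * h x)"
  unfolding set_integrable_def
  using assms by (intro integrable_mult_indicator integrable_gauss_lipschitz) auto

lemma lipschitz_const: "1-lipschitz_on UNIV (\<lambda>_::real. a::real)"
  by (rule lipschitz_onI) auto

lemma lipschitz_id: "1-lipschitz_on UNIV (\<lambda>x::real. x)"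
  by (rule lipschitz_onI) auto

lemma DERIV_gauss_below [derivative_intros]:
  assumes "1-lipschitz_on UNIV h" "(f has_real_derivative f') (at w)"
  shows "((\<lambda>w. gauss_below h (f w)) has_real_derivative std_normal_density (f w) * h (f w) * f') (at w)"
proof -
  have "(gauss_below h has_real_derivative std_normal_density (f w) * h (f w)) (at (f w))"
    unfolding gauss_below_def
    by (intro has_real_derivative_set_integral_atMost integrable_gauss_lipschitz assms continuous_on_mult
      continuous_std_normal_density lipschitz_continuous_real)
  from DERIV_chain2[OF this assms(2)] show ?thesis .
qed

lemma gauss_mean_1: "gauss_mean (\<lambda>_. 1) = 1"
  using integral_std_normal_moment_even[of 0] by (simp add: gauss_mean_def)

lemma gauss_mean_id: "gauss_mean (\<lambda>x. x) = 0"
  using integral_std_normal_moment_odd[of 0] by (simp add: gauss_mean_def)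

lemma gauss_above:
  assumes "1-lipschitz_on UNIV h"
  shows "(LINT x:{w<..}|lborel. std_normal_density x * h x) = gauss_mean h - gauss_below h w"
proof -
  have "gauss_mean h = (LINT x:{..w} \<union> {w<..}|lborel. std_normal_density x * h x)"
    by (auto simp: gauss_mean_def set_lebesgue_integral_def intro!: Bochner_Integration.integral_cong split: split_indicator)
  also have "\<dots> = gauss_below h w + (LINT x:{w<..}|lborel. std_normal_density x * h x)"
    unfolding gauss_below_def
    by (rule set_integral_Un) (auto intro!: set_integrable_gauss_lipschitz assms)
  finally show ?thesis by simp
qed

lemma gauss_below_tendsto_at_top:
  assumes "1-lipschitz_on UNIV h"
  shows "(gauss_below h \<longlongrightarrow> gauss_mean h) at_top"
  using tendsto_integral_at_top[OF _ integrable_gauss_lipschitz[OF assms]]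
  by (simp add: gauss_below_def[abs_def] gauss_mean_def set_lebesgue_integral_def)

lemma std_normal_density_tendsto: "(std_normal_density \<longlongrightarrow> 0) at_top"
  unfolding std_normal_density_def by real_asymp

text \<open>The density has derivative \<open>- x * std_normal_density x\<close>, so
  \<open>G\<close> has derivative 0; its constant value is read off from the limit 0 at
  infinity.\<close>

lemma gauss_below_id: "gauss_below (\<lambda>x. x) w = - std_normal_density w"
proof -
  define G where "G = (\<lambda>w. gauss_below (\<lambda>x. x) w + std_normal_density w)"
  have "DERIV G x :> 0" for x
    unfolding G_def by (auto intro!: derivative_eq_intros lipschitz_id)
  then have "\<And>x. G x = G w" by (intro DERIV_isconst_all allI)
  moreover have "(G \<longlongrightarrow> 0 + 0) at_top"
    unfolding G_def using gauss_below_tendsto_at_top[OF lipschitz_id]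
    by (intro tendsto_add std_normal_density_tendsto) (simp add: gauss_mean_id)
  moreover have "G = (\<lambda>_. G w)" by (rule ext) (rule calculation(1))
  ultimately have "((\<lambda>_::real. G w) \<longlongrightarrow> 0) at_top" by (metis add_0)
  then have "G w = 0" by (simp add: tendsto_const_iff)
  then show ?thesis by (simp add: G_def)
qed

lemma set_integral_abs_bound:
  fixes u v :: "real \<Rightarrow> real"
  assumes "set_integrable lborel A u" "set_integrable lborel A v" "\<And>x. x \<in> A \<Longrightarrow> \<bar>u x\<bar> \<le> v x"
  shows "\<bar>LINT x:A|lborel. u x\<bar> \<le> (LINT x:A|lborel. v x)"
proof -
  have "\<bar>LINT x:A|lborel. u x\<bar> \<le> (LINT x:A|lborel. \<bar>u x\<bar>)"
    using set_integral_norm_bound[OF assms(1)] by simp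
  also have "\<dots> \<le> (LINT x:A|lborel. v x)"
    by (intro set_integral_mono set_integrable_abs assms)
  finally show ?thesis .
qed

text \<open>Inside the absolute value stands the Gaussian integral of \<open>h w - h x\<close> over
  \<open>x \<le> w\<close>. The Lipschitz property replaces the integrand by \<open>w - x\<close>,
  and the right-hand side is that integral, evaluated by \<open>gauss_below_id\<close>.\<close>

lemma gauss_below_diff_bound:
  assumes h: "1-lipschitz_on UNIV h"
  shows "\<bar>h w * normal_cdf w - gauss_below h w\<bar> \<le> w * normal_cdf w + std_normal_density w"
proof -
  note si = set_integrable_gauss_lipschitz[where A = "{..w}"]
  have *: "set_integrable lborel {..w} (\<lambda>x. std_normal_density x * (g w - g x)) \<and>
    (LINT x:{..w}|lborel. std_normal_density x * (g w - g x)) = g w * normal_cdf w - gauss_below g w"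
    if g: "1-lipschitz_on UNIV g" for g
  proof -
    have eq: "std_normal_density x * (g w - g x) = g w * (std_normal_density x * 1) - std_normal_density x * g x" for x
      by (simp add: algebra_simps)
    show ?thesis
      unfolding eq gauss_below_def using si[OF g] si[OF lipschitz_const[of 1]]
      by (auto intro!: set_integral_diff set_integrable_mult_right simp del: mult_1_right)
  qed
  have "\<bar>LINT x:{..w}|lborel. std_normal_density x * (h w - h x)\<bar> \<le> (LINT x:{..w}|lborel. std_normal_density x * (w - x))"
  proof (rule set_integral_abs_bound)
    fix x assume "x \<in> {..w}"
    then have "\<bar>h w - h x\<bar> \<le> w - x" using lipschitz_abs_diff[OF h, of w x] by auto
    then show "\<bar>std_normal_density x * (h w - h x)\<bar> \<le> std_normal_density x * (w - x)"
      by (simp add: abs_mult mult_left_mono)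
  qed (use *[OF h] *[OF lipschitz_id] in auto)
  then show ?thesis
    using *[OF h] *[OF lipschitz_id] by (simp add: gauss_below_id)
qed

lemma gauss_above_diff_bound:
  assumes h: "1-lipschitz_on UNIV h"
  shows "\<bar>gauss_mean h - gauss_below h w - h w * (1 - normal_cdf w)\<bar> \<le> std_normal_density w - w * (1 - normal_cdf w)"
proof -
  note si = set_integrable_gauss_lipschitz[where A = "{w<..}"]
  have *: "set_integrable lborel {w<..} (\<lambda>x. std_normal_density x * (g x - g w)) \<and>
    (LINT x:{w<..}|lborel. std_normal_density x * (g x - g w)) = gauss_mean g - gauss_below g w - g w * (1 - normal_cdf w)"
    if g: "1-lipschitz_on UNIV g" for g
  proof -
    have eq: "std_normal_density x * (g x - g w) = std_normal_density x * g x - g w * (std_normal_density x * 1)" for x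
      by (simp add: algebra_simps)
    have "1 - normal_cdf w = (LINT x:{w<..}|lborel. std_normal_density x * 1)"
      by (simp only: gauss_above[OF lipschitz_const] gauss_mean_1)
    then show ?thesis
      unfolding eq gauss_above[OF g, symmetric] using si[OF g] si[OF lipschitz_const[of 1]]
      by (auto simp del: mult_1_right)
  qed
  have "\<bar>LINT x:{w<..}|lborel. std_normal_density x * (h x - h w)\<bar> \<le> (LINT x:{w<..}|lborel. std_normal_density x * (x - w))"
  proof (rule set_integral_abs_bound)
    fix x assume "x \<in> {w<..}"
    then have "\<bar>h x - h w\<bar> \<le> x - w" using lipschitz_abs_diff[OF h, of x w] by auto
    then show "\<bar>std_normal_density x * (h x - h w)\<bar> \<le> std_normal_density x * (x - w)"
      by (simp add: abs_mult mult_left_mono)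
  qed (use *[OF h] *[OF lipschitz_id] in auto)
  then show ?thesis
    using *[OF h] *[OF lipschitz_id] by (simp add: gauss_below_id gauss_mean_id)
qed

section \<open>Symmetry of the normal distribution and lower bounds for its tail\<close>

lemma std_normal_density_even [simp]: "std_normal_density (- w) = std_normal_density w"
  by (simp add: std_normal_density_def)

text \<open>After reflecting the integration variable the two half-lines differ only in the null set
  \<open>{w}\<close>.\<close>

lemma normal_cdf_uminus: "normal_cdf (- w) = 1 - normal_cdf w"
proof -
  have "normal_cdf (- w) = (LINT x|lborel. indicator {..- w} (0 + (- 1) * x) * std_normal_density (0 + (- 1) * x))"
    unfolding gauss_below_def set_lebesgue_integral_def
    by (subst lborel_integral_real_affine[of "- 1" _ 0]) auto
  also have "\<dots> = (LINT x:{w<..}|lborel. std_normal_density x * 1)"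
    unfolding set_lebesgue_integral_def
  proof (rule integral_cong_AE)
    show "AE x in lborel. indicator {..- w} (0 + (- 1) * x) * std_normal_density (0 + (- 1) * x) =
        indicator {w<..} x *\<^sub>R (std_normal_density x * 1)"
      using AE_lborel_singleton[of w] by eventually_elim (auto split: split_indicator)
  qed auto
  also have "\<dots> = 1 - normal_cdf w"
    by (simp only: gauss_above[OF lipschitz_const] gauss_mean_1)
  finally show ?thesis .
qed

text \<open>The positive root \<open>s\<close> of \<open>s^2 + w * s = 1\<close>. It is Birnbaum's
  lower bound for the Mills ratio, the tail probability divided by the density.\<close>

definition mills_bound :: "real \<Rightarrow> real" where
  "mills_bound w = (sqrt (w\<^sup>2 + 4) - w) / 2"

lemma mills_bound_pos: "mills_bound w > 0"
proof -
  have "\<bar>w\<bar> < sqrt (w\<^sup>2 + 4)" by (rule real_less_rsqrt) simp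
  then show ?thesis by (simp add: mills_bound_def)
qed

lemma mills_bound_eq: "(mills_bound w)\<^sup>2 + w * mills_bound w = 1"
proof -
  have "(sqrt (w\<^sup>2 + 4))\<^sup>2 = w\<^sup>2 + 4" by simp
  then show ?thesis by (simp add: mills_bound_def power2_eq_square field_simps)
qed

text \<open>\<open>G\<close> tends to 1 at infinity, so it suffices that it is nondecreasing. Its
  derivative is the density times \<open>1 - x * s - s / r\<close>, where
  \<open>1 - x * s = s * s\<close> by \<open>mills_bound_eq\<close>, and
  \<open>1 / r \<le> s\<close> makes this nonnegative.\<close>

lemma birnbaum: "std_normal_density w * mills_bound w \<le> 1 - normal_cdf w"
proof -
  define G where "G = (\<lambda>w. normal_cdf w + std_normal_density w * mills_bound w)"
  have deriv: "\<exists>y. DERIV G x :> y \<and> y \<ge> 0" for x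
  proof -
    define r where "r = sqrt (x\<^sup>2 + 4)"
    have r: "r > 0" "r\<^sup>2 = x\<^sup>2 + 4" by (auto simp: r_def add_nonneg_pos)
    define s where "s = mills_bound x"
    have s: "s = (r - x) / 2" by (simp add: s_def mills_bound_def r_def)
    have "x\<^sup>2 + 4 > 0" by (simp add: add_nonneg_pos)
    then have "DERIV mills_bound x :> (2 * x * (inverse r / 2) - 1) / 2"
      unfolding mills_bound_def[abs_def] r_def
      by (auto intro!: derivative_eq_intros)
    also have "(2 * x * (inverse r / 2) - 1) / 2 = - s / r"
      using r(1) by (simp add: s field_simps)
    finally have "DERIV mills_bound x :> - s / r" .
    then have D: "DERIV G x :> std_normal_density x * (1 - x * s - s / r)"
      unfolding G_def s_def
      by (auto intro!: derivative_eq_intros lipschitz_const simp: algebra_simps)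
    have "\<bar>x\<bar> \<le> r" unfolding r_def by (rule real_le_rsqrt) simp
    have "1 - x * s = s * s"
      using mills_bound_eq[of x] by (simp add: s_def power2_eq_square)
    moreover have "1 / r \<le> s" 
    proof -
      \<comment> \<open>Rationalising \<open>s = (r - x) / 2\<close>: the product is 4 and its first
        factor is at most \<open>2 * r\<close>.\<close>
      have "(r + x) * (r - x) = 4" using r(2) by (simp add: power2_eq_square algebra_simps)
      moreover have "(r + x) * (r - x) \<le> 2 * r * (r - x)"
        using \<open>\<bar>x\<bar> \<le> r\<close> by (intro mult_right_mono) auto
      ultimately show ?thesis using r(1) by (simp add: s field_simps)
    qed
    then have "s * (1 / r) \<le> s * s" 
      using mills_bound_pos[of x] by (intro mult_left_mono) (auto simp: s_def)
    ultimately have "1 - x * s - s / r \<ge> 0" by simp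
    then show ?thesis using D by (intro exI[of _ "std_normal_density x * (1 - x * s - s / r)"]) auto
  qed
  have mono: "G w \<le> G x" if "w \<le> x" for x
    using that by (rule DERIV_nonneg_imp_nondecreasing) (use deriv in blast)
  have "((\<lambda>w. std_normal_density w * mills_bound w) \<longlongrightarrow> 0) at_top"
    unfolding std_normal_density_def mills_bound_def by real_asymp
  moreover have "(normal_cdf \<longlongrightarrow> 1) at_top"
    using gauss_below_tendsto_at_top[OF lipschitz_const[of 1]] by (simp add: gauss_mean_1)
  ultimately have "(G \<longlongrightarrow> 1 + 0) at_top"
    unfolding G_def by (intro tendsto_add) simp_all
  then have "G w \<le> 1 + 0"
    by (rule tendsto_lowerbound) (auto simp: eventually_at_top_linorder intro!: exI[of _ w] mono)
  then show ?thesis by (simp add: G_def)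
qed

lemma quartic_bound:
  fixes s :: real
  assumes "0 \<le> s" "s \<le> 1"
  shows "2 / 5 * s ^ 4 + s - s ^ 3 \<le> 23 / 50"
proof -
  \<comment> \<open>The left-hand side attains its maximum, about 0.455, near \<open>s = 37 / 50\<close>.\<close>
  have "23/50 - (2 / 5 * s ^ 4 + s - s ^ 3) = (s - 37/50)\<^sup>2 * (- 2/5 * s\<^sup>2 + 51/125 * s + 5143/6250) +
      (9390912 - 5558400 * s) / 1000000000"
    by (simp add: power2_eq_square power3_eq_cube power4_eq_xxxx field_simps)
  moreover have "0 \<le> (s - 37/50)\<^sup>2 * (- 2/5 * s\<^sup>2 + 51/125 * s + 5143/6250) +
      (9390912 - 5558400 * s) / 1000000000"
  proof -
    have "s\<^sup>2 \<le> 1" using assms by (simp add: power_le_one)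
    then have "0 \<le> - 2/5 * s\<^sup>2 + 51/125 * s + 5143/6250" using assms by linarith
    then have "0 \<le> (s - 37/50)\<^sup>2 * (- 2/5 * s\<^sup>2 + 51/125 * s + 5143/6250)"
      by (intro mult_nonneg_nonneg) simp_all
    moreover have "0 \<le> (9390912 - 5558400 * s) / 1000000000" using assms by simp
    ultimately show ?thesis by linarith
  qed
  ultimately show ?thesis by linarith
qed

lemma std_normal_density_le: "std_normal_density w \<le> 2 / 5"
proof -
  have "5 / 2 \<le> sqrt (2 * pi)" 
    by (rule real_le_rsqrt) (use pi_approx in \<open>simp add: power2_eq_square\<close>)
  then have "1 / sqrt (2 * pi) \<le> 2 / 5" by (simp add: field_simps)
  moreover have "exp (- w\<^sup>2 / 2) \<le> 1" by simp
  ultimately have "1 / sqrt (2 * pi) * exp (- w\<^sup>2 / 2) \<le> 2 / 5 * 1"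
    by (intro mult_mono) auto
  then show ?thesis by (simp add: std_normal_density_def)
qed

text \<open>Twice this constant is the bound \<open>23 / 25\<close> for the derivative of the Stein
  solution. Reflection exchanges the two factors, so let \<open>w \<ge> 0\<close>. With
  \<open>s\<close> the Mills bound, \<open>birnbaum\<close> gives
  \<open>d - w * K \<le> d * s^2\<close>, and the first factor is \<open>w + (d - w * K)\<close>.
  Since \<open>w * s = 1 - s^2\<close>, the product is at most
  \<open>d * (d * s^4 + s - s^3)\<close>, and \<open>d \<le> 2 / 5\<close> leads to
  \<open>quartic_bound\<close>.\<close>

lemma stein_kernel_product_bound:
  "(w * normal_cdf w + std_normal_density w) * (std_normal_density w - w * (1 - normal_cdf w))
    \<le> 23 / 50 * std_normal_density w"
proof -
  have nonneg: "(w * normal_cdf w + std_normal_density w) * (std_normal_density w - w * (1 - normal_cdf w))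
    \<le> 23 / 50 * std_normal_density w" if w: "w \<ge> 0" for w
  proof -
    define s where "s = mills_bound w"
    define d where "d = std_normal_density w"
    define K where "K = 1 - normal_cdf w"
    have d: "d > 0" "d \<le> 2 / 5" using std_normal_density_le[of w] by (auto simp: d_def normal_density_pos)
    have s: "s > 0" "s * s + w * s = 1"
      using mills_bound_pos[of w] mills_bound_eq[of w] by (auto simp: s_def power2_eq_square)
    have s1: "s \<le> 1" 
    proof (rule ccontr)
      assume "\<not> s \<le> 1"
      then have "1 * 1 < s * s" using s by (intro mult_strict_mono) auto
      then show False using s w mult_nonneg_nonneg[of w s] by linarith
    qed
    have K: "d * s \<le> K" using birnbaum[of w] by (simp add: K_def d_def s_def)
    \<comment> \<open>For \<open>h = 0\<close> the left-hand side of
      \<open>gauss_above_diff_bound\<close> is 0, so its right-hand side is nonnegative.\<close>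
    have J: "0 \<le> d - w * K"
      using gauss_above_diff_bound[OF lipschitz_const[of 0], of w] by (simp add: K_def d_def gauss_mean_def)
    have "w * (d * s) \<le> w * K" using K w by (rule mult_left_mono)
    moreover have "d - w * (d * s) = d * (s * s)" using s(2) by algebra
    ultimately have J2: "d - w * K \<le> d * (s * s)" by linarith
    have "(w + (d - w * K)) * (d - w * K) \<le> (w + d * (s * s)) * (d * (s * s))"
      using J J2 w d s by (intro mult_mono add_mono) auto
    also have "\<dots> = d * (d * s ^ 4 + (w * s) * s)" by algebra
    also have "w * s = 1 - s * s" using s(2) by simp
    also have "d * (d * s ^ 4 + (1 - s * s) * s) \<le> d * (2 / 5 * s ^ 4 + (1 - s * s) * s)"
      using d s by (intro mult_left_mono add_mono mult_right_mono) auto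
    also have "(1 - s * s) * s = s - s ^ 3" by algebra
    also have "d * (2 / 5 * s ^ 4 + (s - s ^ 3)) \<le> d * (23 / 50)"
      using quartic_bound[of s] s s1 d by (intro mult_left_mono) auto
    finally show ?thesis by (simp add: K_def d_def algebra_simps)
  qed
  show ?thesis
  proof (cases "w \<ge> 0")
    case True
    then show ?thesis by (rule nonneg)
  next
    case False
    then show ?thesis using nonneg[of "- w"] by (simp add: normal_cdf_uminus algebra_simps)
  qed
qed

text \<open>The classical tail bound, here for both signs of \<open>w\<close>. It follows from
  \<open>birnbaum\<close> because the Mills bound \<open>s\<close> satisfies
  \<open>s * ((1 + w^2) * s - w) = s^4 > 0\<close>. It yields the signs of \<open>A2\<close> and
  \<open>B2\<close> in \<open>stein_solution\<close>.\<close>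

lemma mills_lower: "w * std_normal_density w \<le> (1 + w\<^sup>2) * (1 - normal_cdf w)"
proof -
  define s where "s = mills_bound w"
  have s: "s > 0" "s * s + w * s = 1"
    using mills_bound_pos[of w] mills_bound_eq[of w] by (auto simp: s_def power2_eq_square)
  have "s * ((1 + w\<^sup>2) * s - w) = s ^ 4"
    using s(2) by algebra
  then have "0 < s * ((1 + w\<^sup>2) * s - w)" using s(1) by simp
  then have "w \<le> (1 + w\<^sup>2) * s"
    using s(1) by (simp add: zero_less_mult_iff)
  then have "w * std_normal_density w \<le> ((1 + w\<^sup>2) * s) * std_normal_density w"
    by (rule mult_right_mono) simp
  also have "\<dots> = (1 + w\<^sup>2) * (std_normal_density w * s)" by simp
  also have "\<dots> \<le> (1 + w\<^sup>2) * (1 - normal_cdf w)"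
    using birnbaum[of w] by (intro mult_left_mono) (auto simp: s_def)
  finally show ?thesis .
qed

section \<open>Solution of Stein's equation with bounds on its derivatives\<close>

lemma lipschitz_of_deriv:
  fixes h h' :: "real \<Rightarrow> real"
  assumes "\<And>x. (h has_real_derivative h' x) (at x)" "\<And>x. \<bar>h' x\<bar> \<le> L"
  shows "L-lipschitz_on UNIV h"
proof (rule lipschitz_onI)
  show "dist (h x) (h y) \<le> L * dist x y" for x y
    using field_differentiable_bound[of UNIV h h' L x y] assms by (auto simp: dist_norm has_field_derivative_at_within)
  show "0 \<le> L" using assms(2)[of 0] by linarith
qed

text \<open>\<open>f\<close> is the usual solution \<open>(gauss_below h w - gauss_mean h *
  normal_cdf w) / std_normal_density w\<close>, rewritten in terms of the differences
  \<open>I\<close> and \<open>J\<close>. These have majorants \<open>I1\<close> and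
  \<open>J1\<close> that do not depend on \<open>h\<close>, and in \<open>g\<close> and its
  derivative they occur with coefficients of known sign; hence both bounds reduce to explicit
  expressions in \<open>I1\<close> and \<open>J1\<close>.\<close>

proposition stein_solution:
  fixes h h' :: "real \<Rightarrow> real"
  assumes deriv: "\<And>x. (h has_real_derivative h' x) (at x)" and bound: "\<And>x. \<bar>h' x\<bar> \<le> 1"
  obtains f g where "\<And>x. (f has_real_derivative g x) (at x)"
    "\<And>x. g x - x * f x = h x - gauss_mean h"
    "\<And>x. \<bar>g x\<bar> \<le> 23 / 25"
    "2-lipschitz_on UNIV g"
proof -
  have h: "1-lipschitz_on UNIV h"
    using deriv bound by (rule lipschitz_of_deriv)
  define e where "e w = inverse (std_normal_density w)" for w
  \<comment> \<open>\<open>A\<close> is the Mills ratio of the upper tail and \<open>B\<close> that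
    of the lower tail.\<close>
  define A where "A w = e w * (1 - normal_cdf w)" for w
  define B where "B w = e w * normal_cdf w" for w
  define I where "I w = h w * normal_cdf w - gauss_below h w" for w
  define J where "J w = gauss_mean h - gauss_below h w - h w * (1 - normal_cdf w)" for w
  define I1 where "I1 w = w * normal_cdf w + std_normal_density w" for w
  define J1 where "J1 w = std_normal_density w - w * (1 - normal_cdf w)" for w
  define f where "f w = - (A w * I w + B w * J w)" for w
  define g where "g w = (1 - w * A w) * I w - (w * B w + 1) * J w" for w
  define A2 where "A2 w = A w + w * (w * A w - 1)" for w
  define B2 where "B2 w = B w + w * (w * B w + 1)" for w
  have e [simp]: "e w > 0" "e w * std_normal_density w = 1" "std_normal_density w * e w = 1" for w
    by (auto simp: e_def normal_density_pos less_imp_neq[OF normal_density_pos, symmetric])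
  have AB: "A w + B w = e w" for w by (simp add: A_def B_def algebra_simps)
  have IJ: "I w - J w = h w - gauss_mean h" for w by (simp add: I_def J_def algebra_simps)
  have dA: "(A has_real_derivative w * A w - 1) (at w)" for w
    unfolding A_def e_def
    by (rule derivative_eq_intros lipschitz_const refl less_imp_neq[OF normal_density_pos, symmetric] zero_less_one)+
      (use e[of w] in \<open>simp add: e_def field_simps\<close>)
  have dB: "(B has_real_derivative w * B w + 1) (at w)" for w
    unfolding B_def e_def
    by (rule derivative_eq_intros lipschitz_const refl less_imp_neq[OF normal_density_pos, symmetric] zero_less_one)+
      (use e[of w] in \<open>simp add: e_def field_simps\<close>)
  have dI: "(I has_real_derivative h' w * normal_cdf w) (at w)" for w
    unfolding I_def by (rule derivative_eq_intros lipschitz_const h deriv refl)+ (simp add: algebra_simps)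
  have dJ: "(J has_real_derivative - h' w * (1 - normal_cdf w)) (at w)" for w
    unfolding J_def by (rule derivative_eq_intros lipschitz_const h deriv refl)+ (simp add: algebra_simps)
  have bI: "\<bar>I w\<bar> \<le> I1 w" and bJ: "\<bar>J w\<bar> \<le> J1 w" for w
    using gauss_below_diff_bound[OF h] gauss_above_diff_bound[OF h]
    by (auto simp: I_def J_def I1_def J1_def)
  have I1: "e w * I1 w = w * B w + 1" and J1: "e w * J1 w = 1 - w * A w" for w
    using e[of w] by (simp_all add: I1_def J1_def A_def B_def algebra_simps)
  have nonneg: "0 \<le> w * B w + 1" "0 \<le> 1 - w * A w" for w
    using bI[of w] bJ[of w] less_imp_le[OF e(1), of w]
    by (auto simp flip: I1 J1 intro!: mult_nonneg_nonneg)
  show ?thesis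
  proof
    show "(f has_real_derivative g x) (at x)" for x
    proof -
      have "(f has_real_derivative
          - ((x * A x - 1) * I x + A x * (h' x * normal_cdf x) + ((x * B x + 1) * J x + B x * (- h' x * (1 - normal_cdf x))))) (at x)"
        unfolding f_def by (rule derivative_eq_intros dA dB dI dJ refl)+ (simp add: algebra_simps)
      \<comment> \<open>The two terms with \<open>h'\<close> cancel, so the derivative of
        \<open>f\<close> is free of \<open>h'\<close> and can be differentiated again.\<close>
      moreover have "A x * (h' x * normal_cdf x) = B x * (h' x * (1 - normal_cdf x))"
        by (simp add: A_def B_def)
      ultimately show ?thesis by (simp add: g_def algebra_simps)
    qed
    show "g x - x * f x = h x - gauss_mean h" for x
      using IJ[of x] by (simp add: g_def f_def algebra_simps)
    show "\<bar>g x\<bar> \<le> 23 / 25" for x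
    proof -
      have "\<bar>g x\<bar> \<le> \<bar>(1 - x * A x) * I x\<bar> + \<bar>(x * B x + 1) * J x\<bar>"
        unfolding g_def by linarith
      also have "\<dots> \<le> (1 - x * A x) * I1 x + (x * B x + 1) * J1 x"
        unfolding abs_mult using nonneg bI bJ by (intro add_mono mult_mono) auto
      \<comment> \<open>Each coefficient is the majorant of the other integral divided by the
        density, so both terms equal \<open>e x * I1 x * J1 x\<close>.\<close>
      also have "\<dots> = 2 * e x * (I1 x * J1 x)" by (simp flip: I1 J1)
      also have "\<dots> \<le> 2 * e x * (23 / 50 * std_normal_density x)"
        using stein_kernel_product_bound[of x] less_imp_le[OF e(1)[of x]]
        by (intro mult_left_mono) (auto simp: I1_def J1_def)
      also have "\<dots> = 23 / 25" using e(2)[of x] by simp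
      finally show ?thesis .
    qed
    show "2-lipschitz_on UNIV g"
    proof (rule lipschitz_of_deriv)
      fix x
      have "(g has_real_derivative (- (A x + x * (x * A x - 1)) * I x + (1 - x * A x) * (h' x * normal_cdf x)
          - ((B x + x * (x * B x + 1)) * J x + (x * B x + 1) * (- h' x * (1 - normal_cdf x))))) (at x)"
        unfolding g_def by (rule derivative_eq_intros dA dB dI dJ refl)+ (simp add: algebra_simps)
      \<comment> \<open>This time the terms with \<open>h'\<close> do not cancel; their weights add
        up to 1, which leaves \<open>h' x\<close> itself.\<close>
      moreover have "(1 - x * A x) * normal_cdf x + (x * B x + 1) * (1 - normal_cdf x) = 1"
        by (simp add: A_def B_def algebra_simps)
      then have "(1 - x * A x) * (h' x * normal_cdf x) + (x * B x + 1) * (h' x * (1 - normal_cdf x)) = h' x"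
        by algebra
      ultimately show "(g has_real_derivative h' x - A2 x * I x - B2 x * J x) (at x)"
        unfolding A2_def B2_def by (simp add: algebra_simps)
      have A2: "A2 x \<ge> 0"
      proof -
        have "0 \<le> e x * ((1 + x\<^sup>2) * (1 - normal_cdf x) - x * std_normal_density x)"
          using mills_lower[of x] less_imp_le[OF e(1)[of x]] by (intro mult_nonneg_nonneg) auto
        also have "\<dots> = A2 x" 
          using e(2)[of x] by (simp add: A2_def A_def power2_eq_square algebra_simps)
        finally show ?thesis .
      qed
      have B2: "B2 x \<ge> 0"
      proof -
        have "0 \<le> e x * ((1 + x\<^sup>2) * normal_cdf x + x * std_normal_density x)"
          \<comment> \<open>The lower tail is the upper tail at \<open>- x\<close>.\<close>
          using mills_lower[of "- x"] less_imp_le[OF e(1)[of x]] by (intro mult_nonneg_nonneg) (auto simp: normal_cdf_uminus)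
        also have "\<dots> = B2 x" 
          using e(2)[of x] by (simp add: B2_def B_def power2_eq_square algebra_simps)
        finally show ?thesis .
      qed
      have "\<bar>h' x - A2 x * I x - B2 x * J x\<bar> \<le> 1 + (\<bar>A2 x * I x\<bar> + \<bar>B2 x * J x\<bar>)"
        using bound[of x] by linarith
      also have "\<dots> \<le> 1 + (A2 x * I1 x + B2 x * J1 x)"
        unfolding abs_mult using A2 B2 bI[of x] bJ[of x] by (intro add_mono mult_mono) auto
      \<comment> \<open>The majorants add up to \<open>e x\<close> times the density, which is 1;
        together with \<open>\<bar>h' x\<bar> \<le> 1\<close> this gives the Lipschitz constant
        2.\<close>
      also have "A2 x * I1 x + B2 x * J1 x = (A x + B x) * std_normal_density x"
        using I1[of x] J1[of x] e(2)[of x] 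
        unfolding A2_def B2_def A_def B_def I1_def J1_def by algebra
      finally show "\<bar>h' x - A2 x * I x - B2 x * J x\<bar> \<le> 2" by (simp add: AB)
    qed
  qed
qed

section \<open>Smoothing Lipschitz functions and a Taylor bound\<close>

lemma lipschitz_mollification:
  fixes h :: "real \<Rightarrow> real"
  assumes h: "1-lipschitz_on UNIV h" and "\<epsilon> > 0"
  obtains u u' where "\<And>x. (u has_real_derivative u' x) (at x)" "\<And>x. \<bar>u' x\<bar> \<le> 1"
    "\<And>x. \<bar>u x - h x\<bar> \<le> \<epsilon>"
proof -
  have "isCont h x" for x
    using lipschitz_continuous_real[OF h] by (simp add: continuous_on_eq_continuous_at)
  then obtain H where H: "\<And>x. (H has_real_derivative h x) (at x)"
    using einterval_antiderivative[of "- \<infinity>" "\<infinity>" h] by (auto simp: has_real_derivative_iff_has_vector_derivative)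
  \<comment> \<open>The average of \<open>h\<close> over the window from
    \<open>x - \<epsilon>\<close> to \<open>x + \<epsilon>\<close>, written with an antiderivative:
    its derivative is a difference quotient of \<open>h\<close>, hence at most 1 in absolute value,
    and the mean value theorem turns the average into a value of \<open>h\<close> in the
    window.\<close>
  define u where "u x = (H (x + \<epsilon>) - H (x - \<epsilon>)) / (2 * \<epsilon>)" for x
  show ?thesis
  proof
    show "(u has_real_derivative (h (x + \<epsilon>) - h (x - \<epsilon>)) / (2 * \<epsilon>)) (at x)" for x
      unfolding u_def using \<open>\<epsilon> > 0\<close>
      by (auto intro!: derivative_eq_intros DERIV_chain2[OF H] simp: field_simps)
    show "\<bar>(h (x + \<epsilon>) - h (x - \<epsilon>)) / (2 * \<epsilon>)\<bar> \<le> 1" for x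
      using lipschitz_abs_diff[OF h, of "x + \<epsilon>" "x - \<epsilon>"] \<open>\<epsilon> > 0\<close> by (simp add: abs_divide)
    show "\<bar>u x - h x\<bar> \<le> \<epsilon>" for x
    proof -
      obtain z where z: "x - \<epsilon> < z" "z < x + \<epsilon>" "H (x + \<epsilon>) - H (x - \<epsilon>) = (x + \<epsilon> - (x - \<epsilon>)) * h z"
        using MVT2[of "x - \<epsilon>" "x + \<epsilon>" H h] H \<open>\<epsilon> > 0\<close> by auto
      then have "u x = h z" using \<open>\<epsilon> > 0\<close> by (simp add: u_def)
      then show ?thesis using lipschitz_abs_diff[OF h, of z x] z by auto
    qed
  qed
qed

lemma gauss_mean_close:
  assumes "1-lipschitz_on UNIV u" "1-lipschitz_on UNIV h" "\<And>x. \<bar>u x - h x\<bar> \<le> \<epsilon>"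
  shows "\<bar>gauss_mean u - gauss_mean h\<bar> \<le> \<epsilon>"
proof -
  note int = integrable_gauss_lipschitz[OF assms(1)] integrable_gauss_lipschitz[OF assms(2)]
  have "\<bar>gauss_mean u - gauss_mean h\<bar> = norm (LINT x|lborel. std_normal_density x * u x - std_normal_density x * h x)"
    unfolding gauss_mean_def using int by simp
  also have "\<dots> \<le> (LINT x|lborel. std_normal_density x * \<epsilon>)"
  proof (rule Bochner_Integration.integral_norm_bound_integral)
    show "norm (std_normal_density x * u x - std_normal_density x * h x) \<le> std_normal_density x * \<epsilon>" for x
      using assms(3)[of x] by (simp add: abs_mult mult_left_mono flip: right_diff_distrib)
  qed (use int in auto)
  also have "\<dots> = \<epsilon>"
    using gauss_mean_1 by (simp add: gauss_mean_def)
  finally show ?thesis .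
qed

text \<open>On the segment from \<open>a\<close> to \<open>b\<close>, parametrised by
  \<open>t\<close>, the derivative of \<open>F\<close> is at most \<open>2 * t * (b - a)^2\<close>
  in absolute value. So \<open>F t - t^2 * (b - a)^2\<close> is nonincreasing and
  \<open>F t + t^2 * (b - a)^2\<close> nondecreasing on the unit interval.\<close>

lemma taylor_lipschitz_derivative:
  fixes f g :: "real \<Rightarrow> real"
  assumes f: "\<And>x. (f has_real_derivative g x) (at x)" and g: "2-lipschitz_on UNIV g"
  shows "\<bar>f b - f a - (b - a) * g a\<bar> \<le> (b - a)\<^sup>2"
proof -
  have lip: "\<bar>g x - g y\<bar> \<le> 2 * \<bar>x - y\<bar>" for x y
    using lipschitz_onD[OF g, of x y] by (simp add: dist_real_def)
  define F where "F t = f (a + t * (b - a)) - t * ((b - a) * g a)" for t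
  have dF: "(F has_real_derivative (g (a + t * (b - a)) - g a) * (b - a)) (at t)" for t
    unfolding F_def by (auto intro!: derivative_eq_intros DERIV_chain2[OF f] simp: algebra_simps)
  have *: "\<bar>(g (a + t * (b - a)) - g a) * (b - a)\<bar> \<le> 2 * t * (b - a)\<^sup>2" if "t \<ge> 0" for t
  proof -
    have "\<bar>g (a + t * (b - a)) - g a\<bar> * \<bar>b - a\<bar> \<le> (2 * \<bar>t * (b - a)\<bar>) * \<bar>b - a\<bar>"
      using lip[of "a + t * (b - a)" a] by (intro mult_right_mono) auto
    also have "\<dots> = 2 * t * (b - a)\<^sup>2"
      using that power2_abs[of "b - a"] by (simp only: abs_mult power2_eq_square abs_of_nonneg mult.assoc)
    finally show ?thesis by (simp add: abs_mult)
  qed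
  have "F 1 - 1\<^sup>2 * (b - a)\<^sup>2 \<le> F 0 - 0\<^sup>2 * (b - a)\<^sup>2"
  proof (rule DERIV_nonpos_imp_nonincreasing[of 0 1 "\<lambda>t. F t - t\<^sup>2 * (b - a)\<^sup>2"])
    fix t :: real assume "0 \<le> t" "t \<le> 1"
    moreover have "((\<lambda>t. F t - t\<^sup>2 * (b - a)\<^sup>2) has_real_derivative (g (a + t * (b - a)) - g a) * (b - a) - 2 * t * (b - a)\<^sup>2) (at t)"
      by (auto intro!: derivative_eq_intros dF)
    ultimately show "\<exists>y. ((\<lambda>t. F t - t\<^sup>2 * (b - a)\<^sup>2) has_real_derivative y) (at t) \<and> y \<le> 0"
      using *[of t] by (intro exI[of _ "(g (a + t * (b - a)) - g a) * (b - a) - 2 * t * (b - a)\<^sup>2"]) auto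
  qed simp
  moreover have "F 0 + 0\<^sup>2 * (b - a)\<^sup>2 \<le> F 1 + 1\<^sup>2 * (b - a)\<^sup>2"
  proof (rule DERIV_nonneg_imp_nondecreasing[of 0 1 "\<lambda>t. F t + t\<^sup>2 * (b - a)\<^sup>2"])
    fix t :: real assume "0 \<le> t" "t \<le> 1"
    moreover have "((\<lambda>t. F t + t\<^sup>2 * (b - a)\<^sup>2) has_real_derivative (g (a + t * (b - a)) - g a) * (b - a) + 2 * t * (b - a)\<^sup>2) (at t)"
      by (auto intro!: derivative_eq_intros dF)
    ultimately show "\<exists>y. ((\<lambda>t. F t + t\<^sup>2 * (b - a)\<^sup>2) has_real_derivative y) (at t) \<and> 0 \<le> y"
      using *[of t] by (intro exI[of _ "(g (a + t * (b - a)) - g a) * (b - a) + 2 * t * (b - a)\<^sup>2"]) auto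
  qed simp
  ultimately show ?thesis by (simp add: F_def abs_le_iff)
qed

lemma card_2_obtain:
  assumes "card S = 2" "z \<in> S"
  obtains y where "S = {z, y}" "y \<noteq> z"
  using assms by (metis card_2_iff doubleton_eq_iff insertE singletonD)

text \<open>Here the constant \<open>23 / 25\<close> matters: after squaring,
  \<open>3 * (23 / 25)^2 = 2.5392\<close> must not exceed \<open>8 / pi\<close>, which is about
  2.546.\<close>

lemma quarter_power_bound:
  fixes n :: real
  assumes "n > 0"
  shows "23 / 25 * sqrt (3 * sqrt 2 / sqrt n) \<le> 1 / sqrt pi * (2 powr (7 / 4) / n powr (1 / 4))"
proof (rule power2_le_imp_le)
  have two: "(2 powr (7 / 4))\<^sup>2 = 8 * sqrt (2 :: real)"
  proof -
    have "(2 powr (7 / 4))\<^sup>2 = (2 :: real) powr (3 + 1 / 2)"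
      by (simp add: power2_eq_square flip: powr_add)
    also have "\<dots> = 2 powr 3 * 2 powr (1 / 2)" by (rule powr_add)
    finally show ?thesis by (simp add: powr_half_sqrt)
  qed
  have four: "(n powr (1 / 4))\<^sup>2 = sqrt n"
    using assms by (simp add: power2_eq_square powr_half_sqrt flip: powr_add)
  have "(23 / 25 * sqrt (3 * sqrt 2 / sqrt n))\<^sup>2 = (529 / 625 * 3) * (sqrt 2 / sqrt n)"
    using assms by (simp add: power_mult_distrib power_divide)
  also have "\<dots> \<le> (8 / pi) * (sqrt 2 / sqrt n)"
    using pi_approx assms by (intro mult_right_mono) (auto simp: field_simps)
  also have "\<dots> = (1 / sqrt pi * (2 powr (7 / 4) / n powr (1 / 4)))\<^sup>2"
    by (simp add: power_mult_distrib power_divide two four)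
  finally show "(23 / 25 * sqrt (3 * sqrt 2 / sqrt n))\<^sup>2 \<le> (1 / sqrt pi * (2 powr (7 / 4) / n powr (1 / 4)))\<^sup>2" .
qed (use assms in auto)

section \<open>Averages over colourings\<close>

locale uniform_colouring =
  fixes V :: "'v set" and c :: nat
  assumes finite_V: "finite V" and c_ge_2: "c \<ge> 2"
begin

abbreviation colourings :: "('v \<Rightarrow> nat) set" where
  "colourings \<equiv> V \<rightarrow>\<^sub>E {..<c}"

definition p :: real where "p = 1 / real c"

definition mean :: "(('v \<Rightarrow> nat) \<Rightarrow> real) \<Rightarrow> real" where
  "mean F = (\<Sum>x\<in>colourings. F x) / real (card colourings)"

lemma p_pos: "0 < p" and p_le: "p \<le> 1 / 2"
  using c_ge_2 by (auto simp: p_def field_simps)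

lemma finite_colourings: "finite colourings"
  using finite_V by (auto intro: finite_PiE)

lemma card_colourings: "card colourings = c ^ card V"
  using finite_V by (simp add: card_PiE)

lemma card_colourings_pos: "real (card colourings) > 0"
  using c_ge_2 by (simp add: card_colourings)

lemma mean_cong: "(\<And>x. x \<in> colourings \<Longrightarrow> F x = G x) \<Longrightarrow> mean F = mean G"
  by (simp add: mean_def cong: sum.cong)

lemma mean_mono: "(\<And>x. x \<in> colourings \<Longrightarrow> F x \<le> G x) \<Longrightarrow> mean F \<le> mean G"
  unfolding mean_def by (intro divide_right_mono sum_mono) auto

lemma mean_add: "mean (\<lambda>x. F x + G x) = mean F + mean G"
  by (simp add: mean_def sum.distrib add_divide_distrib)

lemma mean_diff: "mean (\<lambda>x. F x - G x) = mean F - mean G"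
  by (simp add: mean_def sum_subtractf diff_divide_distrib)

lemma mean_cmult: "mean (\<lambda>x. a * F x) = a * mean F"
  by (simp add: mean_def sum_distrib_left)

lemma mean_divide: "mean (\<lambda>x. F x / a) = mean F / a"
  using mean_cmult[of "1 / a" F] by simp

lemma mean_const [simp]: "mean (\<lambda>_. a) = a"
  using card_colourings_pos by (simp add: mean_def)

lemma mean_sum: "mean (\<lambda>x. \<Sum>i\<in>A. F i x) = (\<Sum>i\<in>A. mean (F i))"
  unfolding mean_def by (subst sum.swap) (simp add: sum_divide_distrib)

lemma mean_abs: "\<bar>mean F\<bar> \<le> mean (\<lambda>x. \<bar>F x\<bar>)"
  unfolding mean_def by (auto intro!: divide_right_mono)

text \<open>The variance of \<open>\<bar>F x\<bar>\<close> is nonnegative.\<close>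

lemma mean_abs_le_sqrt: "mean (\<lambda>x. \<bar>F x\<bar>) \<le> sqrt (mean (\<lambda>x. (F x)\<^sup>2))"
proof (rule real_le_rsqrt)
  define a where "a = mean (\<lambda>x. \<bar>F x\<bar>)"
  have "0 \<le> mean (\<lambda>x. (\<bar>F x\<bar> - a)\<^sup>2)"
    using mean_mono[of "\<lambda>_. 0" "\<lambda>x. (\<bar>F x\<bar> - a)\<^sup>2"] by simp
  also have "mean (\<lambda>x. (\<bar>F x\<bar> - a)\<^sup>2) = mean (\<lambda>x. (F x)\<^sup>2 + (- 2 * a) * \<bar>F x\<bar> + a\<^sup>2)"
    by (rule mean_cong) (simp add: power2_eq_square algebra_simps)
  also have "\<dots> = mean (\<lambda>x. (F x)\<^sup>2) - a\<^sup>2"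
    by (simp only: mean_add mean_cmult mean_const flip: a_def) (simp add: power2_eq_square)
  finally show "a\<^sup>2 \<le> mean (\<lambda>x. (F x)\<^sup>2)" by simp
qed

text \<open>The inner average is the conditional expectation given all colours except that of
  \<open>v\<close>. Splitting a colouring into its colour at \<open>v\<close> and the rest turns the
  claim into an exchange of two sums, where the sum over the old colour only contributes the factor
  \<open>c = 1 / p\<close>.\<close>

lemma mean_resample:
  assumes v: "v \<in> V"
  shows "mean F = mean (\<lambda>x. p * (\<Sum>k<c. F (x(v := k))))"
proof -
  define U where "U = V - {v}"
  have V: "V = insert v U" "v \<notin> U" using v by (auto simp: U_def)
  have split: "(\<Sum>x\<in>colourings. G x) = (\<Sum>k<c. \<Sum>y\<in>U \<rightarrow>\<^sub>E {..<c}. G (y(v := k)))" for G :: "('v \<Rightarrow> nat) \<Rightarrow> real"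
  proof -
    have "(\<Sum>x\<in>colourings. G x) = sum G ((\<lambda>(k, y). y(v := k)) ` ({..<c} \<times> (U \<rightarrow>\<^sub>E {..<c})))"
      by (simp add: V PiE_insert_eq)
    also have "\<dots> = (\<Sum>(k, y)\<in>{..<c} \<times> (U \<rightarrow>\<^sub>E {..<c}). G (y(v := k)))"
      by (subst sum.reindex[OF inj_combinator[OF V(2)]]) (auto intro!: sum.cong)
    finally show ?thesis by (simp add: sum.cartesian_product)
  qed
  have "(\<Sum>x\<in>colourings. p * (\<Sum>k<c. F (x(v := k)))) = (\<Sum>j<c. \<Sum>y\<in>U \<rightarrow>\<^sub>E {..<c}. p * (\<Sum>k<c. F (y(v := k))))"
    by (subst split) simp
  also have "\<dots> = (\<Sum>y\<in>U \<rightarrow>\<^sub>E {..<c}. \<Sum>k<c. F (y(v := k)))"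
    using c_ge_2 by (simp add: p_def flip: sum_divide_distrib)
  also have "\<dots> = (\<Sum>x\<in>colourings. F x)"
    by (subst split) (rule sum.swap)
  finally show ?thesis by (simp add: mean_def)
qed

text \<open>Stands in for measurability with respect to the colours of the other vertices. It
  quantifies over all \<open>x\<close> and \<open>k\<close>, so the closure rules need no membership
  in \<open>colourings\<close>.\<close>

definition free_of :: "'v \<Rightarrow> (('v \<Rightarrow> nat) \<Rightarrow> real) \<Rightarrow> bool" where
  "free_of v F \<longleftrightarrow> (\<forall>x k. F (x(v := k)) = F x)"

lemma free_of_const: "free_of v (\<lambda>_. a)"
  by (simp add: free_of_def)

lemma free_of_mult: "free_of v F \<Longrightarrow> free_of v G \<Longrightarrow> free_of v (\<lambda>x. F x * G x)"
  by (simp add: free_of_def)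

lemma free_of_sum: "(\<And>i. i \<in> A \<Longrightarrow> free_of v (F i)) \<Longrightarrow> free_of v (\<lambda>x. \<Sum>i\<in>A. F i x)"
  by (simp add: free_of_def cong: sum.cong)

lemma free_of_prod: "(\<And>i. i \<in> A \<Longrightarrow> free_of v (F i)) \<Longrightarrow> free_of v (\<lambda>x. \<Prod>i\<in>A. F i x)"
  by (simp add: free_of_def cong: prod.cong)

lemma free_of_compose: "free_of v F \<Longrightarrow> free_of v (\<lambda>x. \<phi> (F x))"
  by (simp add: free_of_def)

section \<open>Centred indicators of monochromatic pairs\<close>

definition eta :: "'v set \<Rightarrow> ('v \<Rightarrow> nat) \<Rightarrow> real" where
  "eta e x = (if \<forall>u\<in>e. \<forall>w\<in>e. x u = x w then 1 else 0) - p"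

lemma eta_pair: "eta {a, b} x = (if x a = x b then 1 else 0) - p"
  by (auto simp: eta_def)

lemma free_of_eta: "v \<notin> e \<Longrightarrow> free_of v (eta e)"
proof -
  assume "v \<notin> e"
  then have "(\<forall>u\<in>e. \<forall>w\<in>e. (x(v := k)) u = (x(v := k)) w) \<longleftrightarrow> (\<forall>u\<in>e. \<forall>w\<in>e. x u = x w)" for x :: "'v \<Rightarrow> nat" and k
    by (intro ball_cong refl) auto
  then show "free_of v (eta e)" unfolding free_of_def eta_def by (intro allI) (simp only:)
qed

lemmas free_of_intros = free_of_const free_of_mult free_of_sum free_of_prod free_of_eta

text \<open>Exactly one of the \<open>c\<close> colours agrees with that of \<open>b\<close>, and
  \<open>1 - c * p = 0\<close>.\<close>

lemma sum_eta_pair: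
  assumes "x \<in> colourings" "b \<in> V" "a \<noteq> b"
  shows "(\<Sum>k<c. eta {a, b} (x(a := k))) = 0"
proof -
  have "x b < c" using assms by auto
  have "(\<Sum>k<c. eta {a, b} (x(a := k))) = (\<Sum>k<c. (if x b = k then 1 else 0) - p)"
    using assms by (intro sum.cong) (auto simp: eta_pair)
  also have "\<dots> = 0"
    using \<open>x b < c\<close> c_ge_2 by (simp add: sum_subtractf p_def)
  finally show ?thesis .
qed

lemma mean_eta_zero:
  assumes "a \<in> V" "b \<in> V" "a \<noteq> b" and F: "free_of a F"
  shows "mean (\<lambda>x. F x * eta {a, b} x) = 0"
proof -
  have "mean (\<lambda>x. F x * eta {a, b} x) = mean (\<lambda>x. 0)"
  proof (subst mean_resample[OF \<open>a \<in> V\<close>], rule mean_cong)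
    fix x assume "x \<in> colourings"
    have "(\<Sum>k<c. F (x(a := k)) * eta {a, b} (x(a := k))) = F x * (\<Sum>k<c. eta {a, b} (x(a := k)))"
      using F by (simp add: free_of_def sum_distrib_left)
    then show "p * (\<Sum>k<c. F (x(a := k)) * eta {a, b} (x(a := k))) = 0"
      using sum_eta_pair[OF \<open>x \<in> colourings\<close> assms(2,3)] by simp
  qed
  then show ?thesis by simp
qed

text \<open>As a matrix in the colours of its two vertices, \<open>eta\<close> is the orthogonal
  projection onto the vectors with sum 0. Summing over the colour of the common vertex
  \<open>a\<close> squares this projection and so reproduces it for \<open>{u, w}\<close>, which
  need not be an edge; the factor \<open>p\<close> is the weight of each colour.\<close>

lemma mean_eta_convolution:
  assumes "a \<in> V" "u \<in> V" "w \<in> V" "a \<noteq> u" "a \<noteq> w" and F: "free_of a F"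
  shows "mean (\<lambda>x. F x * (eta {a, u} x * eta {a, w} x)) = p * mean (\<lambda>x. F x * eta {u, w} x)"
proof -
  have "mean (\<lambda>x. F x * (eta {a, u} x * eta {a, w} x)) = mean (\<lambda>x. p * (F x * eta {u, w} x))"
  proof (subst mean_resample[OF \<open>a \<in> V\<close>], rule mean_cong)
    fix x assume x: "x \<in> colourings"
    have lt: "x u < c" "x w < c" using x assms by auto
    define i where "i y k = (if y = k then 1 else 0 :: real)" for y k :: nat
    have "(\<Sum>k<c. F (x(a := k)) * (eta {a, u} (x(a := k)) * eta {a, w} (x(a := k)))) =
        F x * (\<Sum>k<c. (i (x u) k - p) * (i (x w) k - p))"
      unfolding sum_distrib_left
      using F assms(4,5) by (intro sum.cong) (auto simp: free_of_def eta_pair i_def)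
    also have "(\<Sum>k<c. (i (x u) k - p) * (i (x w) k - p)) =
       (\<Sum>k<c. (if x u = k then i (x w) k else 0) + (- p) * i (x u) k + (- p) * i (x w) k + p * p)"
      by (intro sum.cong) (auto simp: i_def algebra_simps)
    also have "\<dots> = (\<Sum>k<c. if x u = k then i (x w) k else 0) + (- p) * (\<Sum>k<c. i (x u) k) + (- p) * (\<Sum>k<c. i (x w) k) + c * (p * p)"
      by (simp only: sum.distrib sum_distrib_left) simp
    also have "\<dots> = i (x w) (x u) + (- p) + (- p) + c * (p * p)"
      using lt by (simp add: i_def)
    also have "\<dots> = eta {u, w} x"
      using c_ge_2 by (auto simp: i_def eta_pair p_def)
    finally show "p * (\<Sum>k<c. F (x(a := k)) * (eta {a, u} (x(a := k)) * eta {a, w} (x(a := k)))) = p * (F x * eta {u, w} x)"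
      by (rule arg_cong)
  qed
  then show ?thesis by (simp add: mean_cmult)
qed

lemma eta_cases: "eta e x = 1 - p \<or> eta e x = - p"
  by (auto simp: eta_def)

text \<open>\<open>eta\<close> takes only two values, so every function of it is affine in it. The
  constant is the expectation of \<open>\<phi>\<close> when the value \<open>1 - p\<close> has
  probability \<open>p\<close>; the linear part disappears under \<open>mean\<close> in
  \<open>mean_fun_eta\<close>.\<close>

lemma fun_eta: "\<phi> (eta e x) = (\<phi> (1 - p) * p + \<phi> (- p) * (1 - p)) + (\<phi> (1 - p) - \<phi> (- p)) * eta e x"
  using eta_cases[of e x] by (elim disjE) (simp_all only:, simp_all add: algebra_simps)

lemma mean_fun_eta:
  assumes "a \<in> V" "b \<in> V" "a \<noteq> b" "free_of a F"
  shows "mean (\<lambda>x. F x * \<phi> (eta {a, b} x)) = (\<phi> (1 - p) * p + \<phi> (- p) * (1 - p)) * mean F"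
proof -
  have "mean (\<lambda>x. F x * \<phi> (eta {a, b} x)) =
      mean (\<lambda>x. (\<phi> (1 - p) * p + \<phi> (- p) * (1 - p)) * F x + (\<phi> (1 - p) - \<phi> (- p)) * (F x * eta {a, b} x))"
    by (intro mean_cong, subst fun_eta[of \<phi>]) (simp add: algebra_simps)
  then show ?thesis
    by (simp only: mean_add mean_cmult mean_eta_zero[OF assms])
qed

section \<open>Correlations of paths with two edges\<close>

definition cherry :: "'v \<Rightarrow> 'v set \<Rightarrow> ('v \<Rightarrow> nat) \<Rightarrow> real" where
  "cherry v S x = (\<Prod>s\<in>S. eta {v, s} x)"

lemma cherry_pair: "a \<noteq> b \<Longrightarrow> cherry v {a, b} x = eta {v, a} x * eta {v, b} x"
  by (simp add: cherry_def)

lemma free_of_cherry: "a \<noteq> v \<Longrightarrow> a \<notin> S \<Longrightarrow> free_of a (cherry v S)"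
  unfolding cherry_def[abs_def] by (intro free_of_prod free_of_eta) auto

text \<open>The leaf \<open>z\<close> enters the cherry through one factor only and does not affect
  \<open>F\<close>, so averaging over its colour gives 0.\<close>

lemma mean_cherry_leaf_zero:
  assumes "S \<subseteq> V" "card S = 2" "v \<in> V" "v \<notin> S" "z \<in> S" "free_of z F"
  shows "mean (\<lambda>x. cherry v S x * F x) = 0"
proof -
  obtain y where S: "S = {z, y}" "y \<noteq> z"
    using assms(2,5) by (metis card_2_iff doubleton_eq_iff insertE singletonD)
  have "mean (\<lambda>x. cherry v S x * F x) = mean (\<lambda>x. (eta {v, y} x * F x) * eta {z, v} x)"
    by (rule mean_cong) (use S in \<open>auto simp: cherry_pair insert_commute mult_ac\<close>)
  also have "\<dots> = 0"
    using assms S by (intro mean_eta_zero free_of_intros) auto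
  finally show ?thesis .
qed

lemma mean_cherry_middle:
  assumes "S \<subseteq> V" "card S = 2" "v \<in> V" "v \<notin> S" "free_of v F"
  shows "mean (\<lambda>x. F x * cherry v S x) = p * mean (\<lambda>x. F x * eta S x)"
proof -
  obtain a b where S: "S = {a, b}" "a \<noteq> b"
    using assms(2) by (meson card_2_iff)
  then show ?thesis
    using mean_eta_convolution[of v a b F] assms by (auto simp: cherry_pair)
qed

lemma mean_eta_sq: "e \<in> nsets V 2 \<Longrightarrow> mean (\<lambda>x. (eta e x)\<^sup>2) = p * (1 - p)"
proof -
  assume "e \<in> nsets V 2"
  then obtain a b where "e = {a, b}" "a \<noteq> b" "a \<in> V" "b \<in> V"
    by (auto simp: nsets_def card_2_iff)
  then show ?thesis
    using mean_fun_eta[of a b "\<lambda>_. 1" "\<lambda>y. y\<^sup>2"] by (simp add: free_of_const power2_eq_square algebra_simps)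
qed

lemma mean_eta_eta:
  assumes "e \<in> nsets V 2" "g \<in> nsets V 2" "e \<noteq> g"
  shows "mean (\<lambda>x. eta e x * eta g x) = 0"
proof -
  have "card e = 2" "card g = 2" "finite g" "finite e" using assms by (auto simp: nsets_def)
  then have "\<not> e \<subseteq> g" using assms(3) by (metis card_subset_eq)
  then obtain a where a: "a \<in> e" "a \<notin> g" by auto
  then obtain b where "e = {a, b}" "a \<noteq> b"
    using \<open>card e = 2\<close> by (metis card_2_iff doubleton_eq_iff insertE singletonD)
  then show ?thesis
    using mean_eta_zero[of a b "eta g"] a assms by (auto simp: free_of_eta mult.commute nsets_def)
qed

text \<open>The vertex \<open>v'\<close> occurs in the second cherry only, so averaging over its
  colour turns that cherry into \<open>p * eta S'\<close>. As \<open>S' = {v, z}\<close>, a leaf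
  \<open>y \<noteq> z\<close> of the first cherry then occurs in a single factor.\<close>

lemma mean_cherry_outside_zero:
  assumes S: "S \<subseteq> V" "card S = 2" "v \<in> V" "v \<notin> S" and S': "S' \<subseteq> V" "card S' = 2" "v' \<in> V" "v' \<notin> S'"
    and "v' \<notin> S" "v \<in> S'" "v \<noteq> v'"
  shows "mean (\<lambda>x. cherry v S x * cherry v' S' x) = 0"
proof -
  have "mean (\<lambda>x. cherry v S x * cherry v' S' x) = p * mean (\<lambda>x. cherry v S x * eta S' x)"
    using assms by (intro mean_cherry_middle free_of_cherry) auto
  moreover obtain z where z: "S' = {v, z}" using card_2_obtain[OF S'(2) \<open>v \<in> S'\<close>] .
  moreover obtain y where "y \<in> S" "y \<noteq> z" using S(2) by (auto simp: card_2_iff)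
  moreover have "mean (\<lambda>x. cherry v S x * eta S' x) = 0"
    using assms z \<open>y \<in> S\<close> \<open>y \<noteq> z\<close> by (intro mean_cherry_leaf_zero[of _ _ y] free_of_eta) auto
  ultimately show ?thesis by simp
qed

text \<open>The cases are sorted by the positions of the middle vertices. The mean can be nonzero
  only for equal cherries, for two cherries inside one triangle, and for equal leaves with different
  middles, a 4-cycle. Everything else is absorbed by \<open>?R \<ge> 0\<close>.\<close>

lemma mean_cherry_cherry:
  assumes S: "S \<subseteq> V" "card S = 2" "v \<in> V" "v \<notin> S" and S': "S' \<subseteq> V" "card S' = 2" "v' \<in> V" "v' \<notin> S'"
  shows "mean (\<lambda>x. cherry v S x * cherry v' S' x) \<le>
    (if insert v S = insert v' S' then p\<^sup>2 * (1 - p)\<^sup>2 else 0) + (if S = S' \<and> v \<noteq> v' then p ^ 3 * (1 - p) else 0)"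
    (is "?E \<le> ?R")
proof -
  have R: "?R \<ge> 0" using p_pos p_le by auto
  have fin: "finite S" "finite S'" using S S' by (auto intro: card_ge_0_finite)
  have ns: "S \<in> nsets V 2" "S' \<in> nsets V 2" using S S' fin by (auto simp: nsets_def)
  have zero: ?thesis if "?E = 0" using R that by simp
  show ?thesis
  proof (cases "v = v'")
    case True
    show ?thesis
    proof (cases "S = S'")
      case eq: True
      obtain a b where ab: "S = {a, b}" "a \<noteq> b" using S(2) by (meson card_2_iff)
      have "?E = mean (\<lambda>x. (eta {v, b} x)\<^sup>2 * (eta {a, v} x)\<^sup>2)"
        using ab by (intro mean_cong) (auto simp: True[symmetric] eq[symmetric] cherry_pair power2_eq_square insert_commute)
      also have "\<dots> = p * (1 - p) * mean (\<lambda>x. (eta {v, b} x)\<^sup>2)"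
        using mean_fun_eta[of a v "\<lambda>x. (eta {v, b} x)\<^sup>2" "\<lambda>y. y\<^sup>2"] ab S
        by (auto simp: power2_eq_square algebra_simps intro!: free_of_intros)
      also have "\<dots> = p\<^sup>2 * (1 - p)\<^sup>2"
        using ab S by (subst mean_eta_sq) (auto simp: nsets_def power2_eq_square)
      finally show ?thesis by (simp add: True eq)
    next
      case False
      then have "\<not> S \<subseteq> S'" using S S' fin by (metis card_subset_eq)
      then obtain z where z: "z \<in> S" "z \<notin> S'" by auto
      show ?thesis
        by (rule zero, rule mean_cherry_leaf_zero[OF S z(1)]) (use z S True in \<open>auto intro!: free_of_cherry\<close>)
    qed
  next
    case neq: False
    consider "v \<notin> S'" "v' \<notin> S" | "v \<in> S'" "v' \<notin> S" | "v \<notin> S'" "v' \<in> S" | "v \<in> S'" "v' \<in> S" by blast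
    then show ?thesis
    proof cases
      case 1
      \<comment> \<open>Neither middle vertex occurs in the other path, so both can be averaged out.
        This leaves \<open>p^2\<close> times the correlation of \<open>eta S\<close> and
        \<open>eta S'\<close>; for \<open>S = S'\<close> it is the 4-cycle.\<close>
      have "?E = mean (\<lambda>x. cherry v' S' x * cherry v S x)" by (simp add: mult.commute)
      also have "\<dots> = p * mean (\<lambda>x. cherry v' S' x * eta S x)"
        using 1 neq S by (intro mean_cherry_middle free_of_cherry) auto
      also have "\<dots> = p * mean (\<lambda>x. eta S x * cherry v' S' x)" by (simp add: mult.commute)
      also have "\<dots> = p * (p * mean (\<lambda>x. eta S x * eta S' x))"
        using 1 S' by (subst mean_cherry_middle) (auto intro!: free_of_eta)
      finally have *: "?E = p * (p * mean (\<lambda>x. eta S x * eta S' x))" .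
      show ?thesis
      proof (cases "S = S'")
        case True
        then have "?E = p ^ 3 * (1 - p)"
          using * mean_eta_sq[OF ns(1)] by (simp add: power2_eq_square power3_eq_cube)
        then show ?thesis using True neq p_pos p_le by auto
      next
        case False
        then show ?thesis using * mean_eta_eta[OF ns] by (intro zero) simp
      qed
    next
      case 2
      then show ?thesis using S S' neq by (intro zero mean_cherry_outside_zero) auto
    next
      case 3
      then have "mean (\<lambda>x. cherry v' S' x * cherry v S x) = 0"
        using S S' neq by (intro mean_cherry_outside_zero) auto
      then show ?thesis by (intro zero) (simp add: mult.commute)
    next
      case 4
      obtain z where z: "S' = {v, z}" "z \<noteq> v" using card_2_obtain[OF S'(2) 4(1)] .
      obtain y where y: "S = {v', y}" "y \<noteq> v'" using card_2_obtain[OF S(2) 4(2)] .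
      have neqs: "z \<noteq> v'" "y \<noteq> v" "v \<in> V" "v' \<in> V" "y \<in> V" "z \<in> V" using S S' y z by auto
      show ?thesis
      proof (cases "y = z")
        case False
        show ?thesis
          by (rule zero, rule mean_cherry_leaf_zero[OF S, of y]) (use False y z neqs in \<open>auto intro!: free_of_cherry\<close>)
      next
        case True
        \<comment> \<open>The paths share the edge \<open>{v, v'}\<close> and the leaf
          \<open>y\<close>; averaging over the colour of \<open>y\<close> closes the triangle and
          leaves a third moment of \<open>eta\<close>.\<close>
        have "?E = mean (\<lambda>x. (eta {v, v'} x)\<^sup>2 * (eta {y, v} x * eta {y, v'} x))"
          using y z neqs True by (intro mean_cong) (auto simp: cherry_pair power2_eq_square insert_commute mult_ac)
        also have "\<dots> = p * mean (\<lambda>x. (eta {v, v'} x)\<^sup>2 * eta {v, v'} x)"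
          using y neqs unfolding power2_eq_square by (intro mean_eta_convolution free_of_intros) auto
        also have "mean (\<lambda>x. (eta {v, v'} x)\<^sup>2 * eta {v, v'} x) = p * (1 - p) * (1 - 2 * p)"
          using mean_fun_eta[of v v' "\<lambda>_. 1" "\<lambda>y. y\<^sup>2 * y"] neqs neq
          by (simp add: free_of_const power2_eq_square algebra_simps)
        also have "p * (p * (1 - p) * (1 - 2 * p)) \<le> p * (p * (1 - p) * (1 - p))"
          using p_pos p_le by (intro mult_left_mono) auto
        also have "\<dots> = p\<^sup>2 * (1 - p)\<^sup>2" by (simp add: power2_eq_square)
        finally show ?thesis using y z True neq neqs by (auto simp: insert_commute)
      qed
    qed
  qed
qed

text \<open>The random colouring takes finitely many values, each with probability
  \<open>(1 / c) ^ card V\<close> by independence, so expectations are finite uniform averages.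
  Restriction to \<open>V\<close> makes it an element of \<open>colourings\<close>.\<close>

lemma colouring_expectation:
  assumes "prob_space M" and V: "V \<noteq> {}"
    and indep: "prob_space.indep_vars M (\<lambda>_. count_space {..<c}) color V"
    and unif: "\<And>v. v \<in> V \<Longrightarrow> distr M (count_space {..<c}) (color v) = uniform_count_measure {..<c}"
  shows "(\<lambda>\<omega>. F (\<lambda>v\<in>V. color v \<omega>)) \<in> borel_measurable M" (is ?meas)
    and "(LINT \<omega>|M. F (\<lambda>v\<in>V. color v \<omega>)) = mean F" (is ?int)
proof -
  interpret prob_space M by fact
  \<comment> \<open>The event that the random colouring equals \<open>x\<close>. For an empty
    \<open>V\<close> the intersection would be the whole type, hence the hypothesis
    \<open>V \<noteq> {}\<close>.\<close>
  define B where "B x = (\<Inter>v\<in>V. color v -` {x v} \<inter> space M)" for x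
  have rv: "color v \<in> M \<rightarrow>\<^sub>M count_space {..<c}" if "v \<in> V" for v
    using indep that by (simp add: indep_vars_def)
  have sets: "B x \<in> sets M" if "x \<in> colourings" for x
    unfolding B_def
  proof (intro sets.finite_INT V finite_V)
    show "color v -` {x v} \<inter> space M \<in> sets M" if "v \<in> V" for v
      using measurable_sets[OF rv[OF that], of "{x v}"] PiE_mem[OF \<open>x \<in> colourings\<close> that] by simp
  qed
  have prob: "prob (B x) = 1 / real (card colourings)" if x: "x \<in> colourings" for x
  proof -
    have "prob (B x) = (\<Prod>v\<in>V. prob (color v -` {x v} \<inter> space M))"
      unfolding B_def using V finite_V x by (intro indep_varsD_finite[OF indep]) auto
    also have "\<dots> = (\<Prod>v\<in>V. 1 / real c)"
    proof (rule prod.cong[OF refl])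
      fix v assume v: "v \<in> V"
      have "prob (color v -` {x v} \<inter> space M) = measure (distr M (count_space {..<c}) (color v)) {x v}"
        using rv[OF v] x v by (subst measure_distr) auto
      also have "\<dots> = 1 / real c"
        using x v by (subst unif[OF v], subst measure_uniform_count_measure) auto
      finally show "prob (color v -` {x v} \<inter> space M) = 1 / real c" .
    qed
    also have "\<dots> = 1 / real (card colourings)"
      by (simp add: card_colourings power_divide)
    finally show ?thesis .
  qed
  have eq: "F (\<lambda>v\<in>V. color v \<omega>) = (\<Sum>x\<in>colourings. F x * indicator (B x) \<omega>)" if "\<omega> \<in> space M" for \<omega>
  proof -
    let ?x = "\<lambda>v\<in>V. color v \<omega>"
    have x: "?x \<in> colourings" using measurable_space[OF rv that] by auto
    have "indicator (B x) \<omega> = (if x = ?x then 1 else 0 :: real)" if "x \<in> colourings" for x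
    proof -
      have "\<omega> \<in> B x \<longleftrightarrow> x = ?x"
        using V \<open>\<omega> \<in> space M\<close> PiE_ext[OF that x] by (auto simp: B_def)
      then show ?thesis by (simp add: indicator_def)
    qed
    then have "(\<Sum>x\<in>colourings. F x * indicator (B x) \<omega>) = (\<Sum>x\<in>colourings. if x = ?x then F x else 0)"
      by (intro sum.cong) auto
    then show ?thesis using x finite_colourings by simp
  qed
  have "(\<lambda>\<omega>. \<Sum>x\<in>colourings. F x * indicator (B x) \<omega>) \<in> borel_measurable M"
    using sets by (intro borel_measurable_sum borel_measurable_times borel_measurable_indicator) auto
  then show ?meas using eq by (simp cong: measurable_cong)
  have "(LINT \<omega>|M. F (\<lambda>v\<in>V. color v \<omega>)) = (LINT \<omega>|M. (\<Sum>x\<in>colourings. F x * indicator (B x) \<omega>))"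
    by (intro Bochner_Integration.integral_cong eq) auto
  also have "\<dots> = (\<Sum>x\<in>colourings. F x * prob (B x))"
    using sets by (subst Bochner_Integration.integral_sum)
      (auto intro!: sum.cong integrable_mult_right integrable_real_indicator simp: emeasure_eq_measure)
  also have "\<dots> = mean F" by (simp add: mean_def prob sum_divide_distrib)
  finally show ?int .
qed

end

section \<open>Counting paths with two edges\<close>

locale coloured_graph = uniform_colouring V c for V :: "'v set" and c :: nat +
  fixes E :: "'v set set"
  assumes edges: "E \<subseteq> nsets V 2" and nonempty: "E \<noteq> {}"
begin

section \<open>Degrees and the anchors of edges\<close>

definition nbrs :: "'v \<Rightarrow> 'v set" where
  "nbrs v = {w. {v, w} \<in> E}"

text \<open>With arbitrary endpoints the sum of the anchor degrees can reach \<open>m^2\<close>, as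
  for the centre of a star; the endpoint of smaller degree keeps it of order
  \<open>m powr (3 / 2)\<close>, by \<open>sum_min_degree\<close>.\<close>

definition anchor :: "'v set \<Rightarrow> 'v" where
  "anchor e = (ARG_MIN (\<lambda>v. card (nbrs v)) v. v \<in> e)"

definition other :: "'v set \<Rightarrow> 'v" where
  "other e = (SOME u. e = {anchor e, u})"

abbreviation m :: nat where "m \<equiv> card E"

lemma edge_subset: "{v, w} \<in> E \<Longrightarrow> v \<in> V \<and> w \<in> V \<and> v \<noteq> w"
  using edges by (auto simp: nsets_def card_insert_if split: if_splits)

lemma finite_E: "finite E"
  using edges by (rule finite_subset) (simp add: finite_V finite_imp_finite_nsets)

lemma m_pos: "real m > 0"
  using finite_E nonempty by (simp add: card_gt_0_iff)

lemma nbrs_subset: "nbrs v \<subseteq> V" and nbrs_irrefl: "v \<notin> nbrs v"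
  by (auto simp: nbrs_def dest: edge_subset) (metis edge_subset insert_absorb2)

lemma finite_nbrs: "finite (nbrs v)"
  using nbrs_subset finite_V by (rule finite_subset)

lemma edge_through:
  assumes "e \<in> E" "v \<in> e"
  shows "\<exists>w\<in>nbrs v. e = {v, w}"
proof -
  have "card e = 2" using assms(1) edges by (auto simp: nsets_def)
  then obtain w where "e = {v, w}" using assms(2) by (rule card_2_obtain)
  then show ?thesis using assms(1) by (auto simp: nbrs_def)
qed

lemma card_nbrs: "card (nbrs v) = card {e \<in> E. v \<in> e}"
proof (rule bij_betw_same_card)
  show "bij_betw (\<lambda>w. {v, w}) (nbrs v) {e \<in> E. v \<in> e}"
  proof (rule bij_betwI')
  qed (auto dest: edge_through simp: nbrs_def doubleton_eq_iff)
qed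

lemma sum_incident: "(\<Sum>e | e \<in> E \<and> v \<in> e. F e) = (\<Sum>w\<in>nbrs v. F {v, w})"
proof (rule sum.reindex_bij_betw[symmetric], rule bij_betwI')
qed (auto dest: edge_through simp: nbrs_def doubleton_eq_iff)

lemma anchor_in: "e \<in> E \<Longrightarrow> anchor e \<in> e"
  and anchor_min: "e \<in> E \<Longrightarrow> v \<in> e \<Longrightarrow> card (nbrs (anchor e)) \<le> card (nbrs v)"
proof -
  have *: "anchor e \<in> e \<and> (\<forall>v. v \<in> e \<longrightarrow> card (nbrs (anchor e)) \<le> card (nbrs v))" if "e \<in> E"
  proof -
    obtain a where "a \<in> e" using \<open>e \<in> E\<close> edges by (auto simp: nsets_def card_2_iff)
    then show ?thesis unfolding anchor_def by (rule arg_min_nat_lemma)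
  qed
  show "e \<in> E \<Longrightarrow> anchor e \<in> e" "e \<in> E \<Longrightarrow> v \<in> e \<Longrightarrow> card (nbrs (anchor e)) \<le> card (nbrs v)"
    using * by auto
qed

lemma edge_eq: assumes "e \<in> E" shows "{anchor e, other e} = e"
proof -
  have "card e = 2" using assms edges by (auto simp: nsets_def)
  then obtain u where "e = {anchor e, u}" using edge_through[OF assms anchor_in[OF assms]] by auto
  then have "e = {anchor e, other e}" unfolding other_def by (rule someI)
  then show ?thesis by simp
qed

lemma ends: assumes "e \<in> E" shows "anchor e \<in> V" "other e \<in> V" "anchor e \<noteq> other e" "other e \<in> nbrs (anchor e)"
  using edge_eq[OF assms] edge_subset[of "anchor e" "other e"] assms by (auto simp: nbrs_def)

lemma handshake: "(\<Sum>v\<in>V. card (nbrs v)) = 2 * m"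
proof -
  have "(\<Sum>v\<in>V. card (nbrs v)) = (\<Sum>v\<in>V. \<Sum>e\<in>E. if v \<in> e then 1 else 0)"
    using finite_E by (simp add: card_nbrs sum.If_cases Int_def)
  also have "\<dots> = (\<Sum>e\<in>E. card (V \<inter> e))"
    using finite_V by (subst sum.swap) (simp add: sum.If_cases)
  also have "\<dots> = (\<Sum>e\<in>E. 2)"
    using edges by (intro sum.cong) (auto simp: nsets_def Int_absorb1)
  finally show ?thesis by simp
qed

text \<open>Counting degrees level by level: the edges inside \<open>{v. t \<le> deg v}\<close>, a set of \<open>n\<close> vertices,
  number at most \<open>min m (n\<^sup>2 / 2) \<le> n * sqrt (m / 2)\<close>, and these \<open>n\<close> add up to \<open>2 * m\<close> over all \<open>t\<close>.\<close>

lemma sum_min_degree: "(\<Sum>e\<in>E. real (card (nbrs (anchor e)))) \<le> sqrt 2 * real m * sqrt (real m)"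
proof -
  define U where "U t = {v \<in> V. t \<le> card (nbrs v)}" for t
  have deg_le: "card (nbrs v) \<le> card V" for v
    using nbrs_subset finite_V by (simp add: card_mono)
  have level: "real n = (\<Sum>t=1..card V. if t \<le> n then 1 else 0)" if "n \<le> card V" for n
  proof -
    have "{1..card V} \<inter> {t. t \<le> n} = {1..n}" using that by auto
    then show ?thesis by (simp add: sum.If_cases)
  qed
  have inside: "real (card {e \<in> E. t \<le> card (nbrs (anchor e))}) \<le> real (card (U t)) * sqrt (real m / 2)" for t
  proof (rule power2_le_imp_le)
    let ?A = "{e \<in> E. t \<le> card (nbrs (anchor e))}"
    have fin: "finite (U t)" using finite_V by (simp add: U_def)
    \<comment> \<open>The anchor has the smallest degree in its edge, so both ends of an edge in
      \<open>?A\<close> have degree at least \<open>t\<close>.\<close>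
    have "?A \<subseteq> nsets (U t) 2"
      using edges anchor_min by (auto simp: nsets_def U_def intro: order_trans)
    then have "card ?A \<le> card (U t) choose 2"
      using card_mono[OF finite_imp_finite_nsets[OF fin]] by (metis card_nsets)
    then have "2 * card ?A \<le> card (U t) * (card (U t) - 1)" by (simp add: choose_two)
    also have "\<dots> \<le> card (U t) * card (U t)" by simp
    finally have "real (2 * card ?A) \<le> real (card (U t) * card (U t))" by (simp only: of_nat_le_iff)
    then have 1: "real (card ?A) \<le> (real (card (U t)))\<^sup>2 / 2" by (simp add: power2_eq_square)
    have 2: "card ?A \<le> m" using finite_E by (intro card_mono) auto
    have "(real (card ?A))\<^sup>2 \<le> ((real (card (U t)))\<^sup>2 / 2) * real m"
      unfolding power2_eq_square[of "real (card ?A)"] using 1 2 by (intro mult_mono) auto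
    then show "(real (card ?A))\<^sup>2 \<le> (real (card (U t)) * sqrt (real m / 2))\<^sup>2"
      by (simp add: power_mult_distrib)
  qed simp
  have "(\<Sum>e\<in>E. real (card (nbrs (anchor e)))) = (\<Sum>e\<in>E. \<Sum>t=1..card V. if t \<le> card (nbrs (anchor e)) then 1 else 0)"
    by (intro sum.cong level deg_le refl)
  also have "\<dots> = (\<Sum>t=1..card V. real (card {e \<in> E. t \<le> card (nbrs (anchor e))}))"
    using finite_E by (subst sum.swap) (simp add: sum.If_cases Int_def)
  also have "\<dots> \<le> (\<Sum>t=1..card V. real (card (U t)) * sqrt (real m / 2))"
    by (intro sum_mono inside)
  also have "\<dots> = (\<Sum>t=1..card V. real (card (U t))) * sqrt (real m / 2)"
    by (simp add: sum_distrib_right)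
  also have "(\<Sum>t=1..card V. real (card (U t))) = (\<Sum>t=1..card V. \<Sum>v\<in>V. if t \<le> card (nbrs v) then 1 else 0)"
    using finite_V by (simp add: sum.If_cases Int_def U_def)
  also have "\<dots> = (\<Sum>v\<in>V. real (card (nbrs v)))"
    by (subst sum.swap) (simp only: level[OF deg_le])
  also have "\<dots> = 2 * real m" using handshake by (simp flip: of_nat_sum)
  also have "2 * real m * sqrt (real m / 2) = sqrt 2 * real m * sqrt (real m)"
    by (simp add: real_sqrt_divide field_simps) 
  finally show ?thesis .
qed

text \<open>The path from \<open>other e\<close> through \<open>anchor e\<close> to \<open>w\<close>
  is recorded by its edge \<open>e\<close> and its second leaf \<open>w\<close>. A path is recorded
  twice when its middle vertex is the anchor of both of its edges.\<close>

definition cherries :: "('v set \<times> 'v) set" where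
  "cherries = Sigma E (\<lambda>e. nbrs (anchor e) - {other e})"

lemma finite_cherries: "finite cherries"
  unfolding cherries_def using finite_E finite_nbrs by auto

lemma card_cherries: "real (card cherries) \<le> sqrt 2 * real m * sqrt (real m)"
proof -
  have "real (card cherries) = (\<Sum>e\<in>E. real (card (nbrs (anchor e) - {other e})))"
    using finite_E finite_nbrs by (simp add: cherries_def card_SigmaI)
  also have "\<dots> \<le> (\<Sum>e\<in>E. real (card (nbrs (anchor e))))"
    using finite_nbrs by (intro sum_mono) (simp add: card_Diff1_le)
  finally show ?thesis using sum_min_degree by linarith
qed

lemma cherryD:
  assumes "(e, w) \<in> cherries"
  shows "e \<in> E" "anchor e \<in> V" "{other e, w} \<subseteq> V" "card {other e, w} = 2" "anchor e \<notin> {other e, w}" "w \<in> nbrs (anchor e)"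
    "w \<notin> e" "insert (anchor e) {other e, w} = insert w e"
proof -
  have *: "e \<in> E" "w \<in> nbrs (anchor e)" "w \<noteq> other e" using assms by (auto simp: cherries_def)
  then have "w \<noteq> anchor e" "w \<in> V" using nbrs_irrefl nbrs_subset by auto
  then show "e \<in> E" "anchor e \<in> V" "{other e, w} \<subseteq> V" "card {other e, w} = 2" "anchor e \<notin> {other e, w}" "w \<in> nbrs (anchor e)"
    using * ends[of e] by auto
  show "w \<notin> e" "insert (anchor e) {other e, w} = insert w e"
    using edge_eq[of e] * \<open>w \<noteq> anchor e\<close> by auto
qed

text \<open>A cherry with support \<open>?S\<close> is determined by its edge \<open>e'\<close>,
  since \<open>w'\<close> is the vertex of \<open>?S\<close> outside \<open>e'\<close>; and
  \<open>?S\<close> has three subsets of size 2.\<close>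

lemma card_same_support:
  assumes q: "(e, w) \<in> cherries"
  shows "card {(e', w') \<in> cherries. insert w e = insert w' e'} \<le> 3"
proof -
  let ?A = "{(e', w') \<in> cherries. insert w e = insert w' e'}" and ?S = "insert w e"
  have "card e = 2" "finite e" using cherryD(1)[OF q] edges by (auto simp: nsets_def)
  then have S: "card ?S = 3" "finite ?S" 
    using cherryD(7)[OF q] by auto
  have "inj_on fst ?A"
  proof (rule inj_onI)
    fix q1 q2 assume *: "q1 \<in> ?A" "q2 \<in> ?A" "fst q1 = fst q2"
    then obtain e' w1 w2 where q12: "q1 = (e', w1)" "q2 = (e', w2)" by (metis prod.collapse)
    then have "insert w1 e' = insert w2 e'" "(e', w1) \<in> cherries" "(e', w2) \<in> cherries" using * by auto
    then have "w1 = w2" using cherryD(7)[of e' w1] cherryD(7)[of e' w2] by blast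
    then show "q1 = q2" using q12 by simp
  qed
  moreover have "fst ` ?A \<subseteq> nsets ?S 2"
  proof clarsimp
    fix e' w' assume "(e', w') \<in> cherries" "insert w e = insert w' e'"
    then show "e' \<in> nsets (insert w' e') 2"
      using cherryD(1)[of e' w'] edges by (auto simp: nsets_def)
  qed
  ultimately have "card ?A \<le> card (nsets ?S 2)"
    by (rule card_inj_on_le) (rule finite_imp_finite_nsets[OF S(2)])
  also have "card (nsets ?S 2) = 3" by (simp only: card_nsets S) (simp add: choose_two)
  finally show ?thesis .
qed

text \<open>Equal leaf sets match the leaves in one of two ways. In \<open>A\<close>, crosswise, the
  two edges determine everything: at most \<open>m^2\<close> pairs. In \<open>B\<close>, straight,
  the first edge together with the anchor and second leaf of the other cherry suffices; the latter
  two form one of \<open>2 * m\<close> oriented edges, so there are at most \<open>2 * m^2\<close>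
  pairs.\<close>

lemma card_opposite:
  "card {(q, q') \<in> cherries \<times> cherries. {other (fst q), snd q} = {other (fst q'), snd q'}} \<le> 3 * m\<^sup>2"
proof -
  let ?Q = "\<lambda>f. {(q, q'). q \<in> cherries \<and> q' \<in> cherries \<and> f q q'}"
  define A where "A = ?Q (\<lambda>q q'. other (fst q') = snd q \<and> snd q' = other (fst q))"
  define B where "B = ?Q (\<lambda>q q'. other (fst q') = other (fst q) \<and> snd q' = snd q)"
  have fin: "finite A" "finite B"
    by (rule finite_subset[of _ "cherries \<times> cherries"], auto simp: A_def B_def finite_cherries)+
  have "card A \<le> card (E \<times> E)"
  proof (rule card_inj_on_le)
    show "inj_on (\<lambda>(q, q'). (fst q, fst q')) A"
      by (rule inj_onI) (auto simp: A_def)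
    show "(\<lambda>(q, q'). (fst q, fst q')) ` A \<subseteq> E \<times> E"
      by (auto simp: A_def cherryD)
  qed (simp add: finite_E)
  moreover have "card B \<le> card (E \<times> Sigma V nbrs)"
  proof (rule card_inj_on_le)
    show "inj_on (\<lambda>(q, q'). (fst q, (anchor (fst q'), snd q'))) B"
    proof (rule inj_onI, clarsimp simp: B_def)
      fix e e1 e2 w assume *: "(e1, w) \<in> cherries" "(e2, w) \<in> cherries" "anchor e1 = anchor e2" "other e1 = other e" "other e2 = other e"
      show "e1 = e2"
        using edge_eq[OF cherryD(1)[OF *(1)]] edge_eq[OF cherryD(1)[OF *(2)]] * by simp
    qed
    show "(\<lambda>(q, q'). (fst q, (anchor (fst q'), snd q'))) ` B \<subseteq> E \<times> Sigma V nbrs"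
      using cherryD(1,2,6) by (fastforce simp: B_def)
  qed (use finite_E finite_V finite_nbrs in auto)
  moreover have "card (Sigma V nbrs) = 2 * m"
    using finite_V finite_nbrs handshake by (simp add: card_SigmaI)
  moreover have "{(q, q') \<in> cherries \<times> cherries. {other (fst q), snd q} = {other (fst q'), snd q'}} \<subseteq> A \<union> B"
    by (auto simp: A_def B_def doubleton_eq_iff)
  then have "card {(q, q') \<in> cherries \<times> cherries. {other (fst q), snd q} = {other (fst q'), snd q'}} \<le> card A + card B"
    using fin by (meson card_Un_le card_mono finite_UnI order_trans)
  ultimately show ?thesis
    by (simp add: power2_eq_square card_cartesian_product algebra_simps)
qed

definition cherry_sum :: "('v \<Rightarrow> nat) \<Rightarrow> real" where
  "cherry_sum x = (\<Sum>(e, w)\<in>cherries. cherry (anchor e) {other e, w} x)"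

text \<open>The square is expanded and \<open>mean_cherry_cherry\<close> applied to each pair. By
  \<open>card_same_support\<close> every cherry has at most three partners of the first kind;
  \<open>card_opposite\<close> counts the second kind.\<close>

lemma mean_cherry_sum_sq:
  "mean (\<lambda>x. (cherry_sum x)\<^sup>2) \<le> p\<^sup>2 * (1 - p)\<^sup>2 * (3 * real (card cherries)) + p ^ 3 * (1 - p) * (3 * (real m)\<^sup>2)"
proof -
  define F where "F q = cherry (anchor (fst q)) {other (fst q), snd q}" for q
  define a where "a q q' = (if insert (snd q) (fst q) = insert (snd q') (fst q') then 1 else 0 :: real)" for q q' :: "'v set \<times> 'v"
  \<comment> \<open>This counts pairs with equal middles as well, which can only increase the
    bound.\<close>
  define b where "b q q' = (if {other (fst q), snd q} = {other (fst q'), snd q'} then 1 else 0 :: real)" for q q' :: "'v set \<times> 'v"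
  have pair: "mean (\<lambda>x. F q x * F q' x) \<le> p\<^sup>2 * (1 - p)\<^sup>2 * a q q' + p ^ 3 * (1 - p) * b q q'"
    if "q \<in> cherries" "q' \<in> cherries" for q q'
  proof -
    obtain e w e' w' where q: "q = (e, w)" "q' = (e', w')" by (cases q, cases q')
    note D = cherryD[OF that(1)[unfolded q]] cherryD[OF that(2)[unfolded q]]
    have nn: "0 \<le> p ^ 3 * (1 - p)" using p_pos p_le by simp
    have "mean (\<lambda>x. F q x * F q' x) \<le> (if insert w e = insert w' e' then p\<^sup>2 * (1 - p)\<^sup>2 else 0) +
        (if {other e, w} = {other e', w'} \<and> anchor e \<noteq> anchor e' then p ^ 3 * (1 - p) else 0)"
      using mean_cherry_cherry[OF D(3,4,2,5) D(11,12,10,13)] unfolding D(8) D(16) by (simp only: F_def q fst_conv snd_conv)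
    also have "(if insert w e = insert w' e' then p\<^sup>2 * (1 - p)\<^sup>2 else 0) = p\<^sup>2 * (1 - p)\<^sup>2 * a q q'"
      by (simp add: a_def q)
    also have "(if {other e, w} = {other e', w'} \<and> anchor e \<noteq> anchor e' then p ^ 3 * (1 - p) else 0) \<le> p ^ 3 * (1 - p) * b q q'"
      using nn by (simp add: b_def q)
    finally show ?thesis by simp
  qed
  have "mean (\<lambda>x. (cherry_sum x)\<^sup>2) = (\<Sum>q\<in>cherries. \<Sum>q'\<in>cherries. mean (\<lambda>x. F q x * F q' x))"
    by (simp add: cherry_sum_def F_def case_prod_unfold power2_eq_square sum_product mean_sum)
  also have "\<dots> \<le> (\<Sum>q\<in>cherries. \<Sum>q'\<in>cherries. p\<^sup>2 * (1 - p)\<^sup>2 * a q q' + p ^ 3 * (1 - p) * b q q')"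
    by (intro sum_mono pair)
  also have "\<dots> = p\<^sup>2 * (1 - p)\<^sup>2 * (\<Sum>q\<in>cherries. \<Sum>q'\<in>cherries. a q q') + p ^ 3 * (1 - p) * (\<Sum>q\<in>cherries. \<Sum>q'\<in>cherries. b q q')"
    by (simp add: sum.distrib sum_distrib_left)
  also have "\<dots> \<le> p\<^sup>2 * (1 - p)\<^sup>2 * (3 * real (card cherries)) + p ^ 3 * (1 - p) * (3 * (real m)\<^sup>2)"
  proof (intro add_mono mult_left_mono)
    have "(\<Sum>q'\<in>cherries. a q q') \<le> 3" if "q \<in> cherries" for q
    proof -
      have "(\<Sum>q'\<in>cherries. a q q') = real (card {(e', w') \<in> cherries. insert (snd q) (fst q) = insert w' e'})"
        using finite_cherries by (simp add: a_def sum.If_cases Int_def case_prod_unfold)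
      also have "\<dots> \<le> 3" using card_same_support[of "fst q" "snd q"] that by simp
      finally show ?thesis .
    qed
    then have "(\<Sum>q\<in>cherries. \<Sum>q'\<in>cherries. a q q') \<le> (\<Sum>q\<in>cherries. 3)" by (rule sum_mono)
    then show "(\<Sum>q\<in>cherries. \<Sum>q'\<in>cherries. a q q') \<le> 3 * real (card cherries)" by simp
    have "(\<Sum>q\<in>cherries. \<Sum>q'\<in>cherries. b q q') =
        real (card {(q, q') \<in> cherries \<times> cherries. {other (fst q), snd q} = {other (fst q'), snd q'}})"
    proof -
      have "{(q, q') \<in> cherries \<times> cherries. {other (fst q), snd q} = {other (fst q'), snd q'}} =
          Sigma cherries (\<lambda>q. {q' \<in> cherries. {other (fst q), snd q} = {other (fst q'), snd q'}})"
        by auto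
      then show ?thesis
        using finite_cherries by (simp add: b_def sum.If_cases Int_def card_SigmaI)
    qed
    also have "\<dots> \<le> real (3 * m\<^sup>2)" using card_opposite by (simp only: of_nat_le_iff)
    finally show "(\<Sum>q\<in>cherries. \<Sum>q'\<in>cherries. b q q') \<le> 3 * (real m)\<^sup>2" by simp
  qed (use p_pos p_le in auto)
  finally show ?thesis .
qed

section \<open>Stein's method for the number of monochromatic edges\<close>

definition sigma :: real where "sigma = sqrt (real m * (p * (1 - p)))"

definition W :: "('v \<Rightarrow> nat) \<Rightarrow> real" where
  "W x = (\<Sum>e\<in>E. eta e x) / sigma"

definition D :: "'v set \<Rightarrow> ('v \<Rightarrow> nat) \<Rightarrow> real" where
  "D e x = (\<Sum>w\<in>nbrs (anchor e). eta {anchor e, w} x) / sigma"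

text \<open>The edge \<open>e\<close> is split off from the sum at its anchor: its own contribution
  is computed exactly, while \<open>eta e * R e\<close> consists of cherries. Unlike
  \<open>D\<close>, this sum is not divided by \<open>sigma\<close>.\<close>

definition R :: "'v set \<Rightarrow> ('v \<Rightarrow> nat) \<Rightarrow> real" where
  "R e x = (\<Sum>w\<in>nbrs (anchor e) - {other e}. eta {anchor e, w} x)"

lemma p_less: "p < 1"
  using p_le by simp

lemma sigma_pos: "sigma > 0" and sigma_sq: "sigma\<^sup>2 = real m * (p * (1 - p))"
  using m_pos p_pos p_less by (auto simp: sigma_def)

lemma D_eq: "e \<in> E \<Longrightarrow> D e x = (eta e x + R e x) / sigma"
  using sum.remove[OF finite_nbrs ends(4), of e "\<lambda>w. eta {anchor e, w} x"]
  by (simp add: D_def R_def edge_eq)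

lemma free_of_W_minus_D: "free_of (anchor e) (\<lambda>x. \<phi> (W x - D e x))"
proof -
  have "W x - D e x = (\<Sum>g | g \<in> E \<and> anchor e \<notin> g. eta g x) / sigma" for x
  proof -
    have "(\<Sum>g\<in>E. eta g x) = (\<Sum>g | g \<in> E \<and> anchor e \<in> g. eta g x) + (\<Sum>g | g \<in> E \<and> anchor e \<notin> g. eta g x)"
      using finite_E by (subst sum.union_disjoint[symmetric]) (auto intro!: sum.cong)
    then show ?thesis
      by (simp add: W_def D_def sum_incident diff_divide_distrib[symmetric])
  qed
  then show ?thesis
    by (simp only:) (rule free_of_compose[where \<phi> = "\<lambda>y. \<phi> (y / sigma)"], rule free_of_sum, rule free_of_eta, simp)
qed

lemma mean_eta_W_minus_D:
  assumes "e \<in> E"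
  shows "mean (\<lambda>x. eta e x * \<phi> (W x - D e x)) = 0"
  using mean_eta_zero[OF ends(1-3)[OF assms] free_of_W_minus_D[where \<phi> = \<phi> and e = e]] assms
  by (simp add: edge_eq mult.commute)

text \<open>Distinct edges are uncorrelated even if they share a vertex, so only the diagonal of the
  squared sum remains.\<close>

lemma mean_W_sq: "mean (\<lambda>x. (W x)\<^sup>2) = 1"
proof -
  have "mean (\<lambda>x. (\<Sum>e\<in>E. eta e x)\<^sup>2) = (\<Sum>e\<in>E. \<Sum>g\<in>E. mean (\<lambda>x. eta e x * eta g x))"
    by (simp add: power2_eq_square sum_product mean_sum)
  also have "\<dots> = (\<Sum>e\<in>E. \<Sum>g\<in>E. if e = g then p * (1 - p) else 0)"
  proof (intro sum.cong refl)
    fix e g assume "e \<in> E" "g \<in> E"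
    then show "mean (\<lambda>x. eta e x * eta g x) = (if e = g then p * (1 - p) else 0)"
      using mean_eta_eta[of e g] mean_eta_sq[of e] edges by (auto simp: power2_eq_square)
  qed
  also have "\<dots> = sigma\<^sup>2" using finite_E by (simp add: sigma_sq)
  finally show ?thesis
    using sigma_pos by (simp add: W_def power_divide mean_divide)
qed

lemma mean_abs_W: "mean (\<lambda>x. \<bar>W x\<bar>) \<le> 1"
  using mean_abs_le_sqrt[of W] by (simp add: mean_W_sq)

section \<open>Moments of the local terms\<close>

lemma nbrs_other:
  assumes "e \<in> E" "w \<in> nbrs (anchor e) - {other e}"
  shows "w \<in> V" "w \<noteq> anchor e" "w \<notin> e"
proof -
  show *: "w \<in> V" "w \<noteq> anchor e" using assms nbrs_subset nbrs_irrefl by auto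
  have "e \<subseteq> {anchor e, other e}" by (simp add: edge_eq[OF assms(1)])
  then show "w \<notin> e" using * assms(2) by auto
qed

text \<open>Each summand of \<open>R e\<close> has an endpoint \<open>w\<close> outside
  \<open>e\<close>, whose colour can be averaged out.\<close>

lemma mean_eta_R:
  assumes "e \<in> E"
  shows "mean (\<lambda>x. \<phi> (eta e x) * R e x) = 0"
proof -
  have "mean (\<lambda>x. \<phi> (eta e x) * eta {anchor e, w} x) = 0" if "w \<in> nbrs (anchor e) - {other e}" for w
  proof -
    have "free_of w (\<lambda>x. \<phi> (eta e x))"
      by (rule free_of_compose, rule free_of_eta) (rule nbrs_other[OF assms that])
    then show ?thesis
      using mean_eta_zero[of w "anchor e" "\<lambda>x. \<phi> (eta e x)"] nbrs_other[OF assms that] ends[OF assms]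
      by (simp add: insert_commute)
  qed
  then show ?thesis
    by (simp add: R_def sum_distrib_left mean_sum)
qed

text \<open>Given the colours on \<open>e\<close>, the summands of \<open>R e\<close> are
  uncorrelated with variance \<open>p * (1 - p)\<close>: for \<open>w \<noteq> z\<close> the colour
  of \<open>w\<close> enters one factor only.\<close>

lemma mean_eta_R_sq:
  assumes "e \<in> E"
  shows "mean (\<lambda>x. \<phi> (eta e x) * (R e x)\<^sup>2) =
    p * (1 - p) * mean (\<lambda>x. \<phi> (eta e x)) * real (card (nbrs (anchor e) - {other e}))"
proof -
  let ?N = "nbrs (anchor e) - {other e}"
  have "mean (\<lambda>x. \<phi> (eta e x) * (R e x)\<^sup>2) =
      (\<Sum>w\<in>?N. \<Sum>z\<in>?N. mean (\<lambda>x. \<phi> (eta e x) * (eta {anchor e, w} x * eta {anchor e, z} x)))"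
    unfolding R_def power2_eq_square sum_product unfolding sum_distrib_left mean_sum ..
  also have "\<dots> = (\<Sum>w\<in>?N. \<Sum>z\<in>?N. if w = z then p * (1 - p) * mean (\<lambda>x. \<phi> (eta e x)) else 0)"
  proof (intro sum.cong refl)
    fix w z assume w: "w \<in> ?N" and z: "z \<in> ?N"
    note w' = nbrs_other[OF assms w]
    have \<phi>: "free_of w (\<lambda>x. \<phi> (eta e x))" by (rule free_of_compose, rule free_of_eta, rule w')
    show "mean (\<lambda>x. \<phi> (eta e x) * (eta {anchor e, w} x * eta {anchor e, z} x)) =
        (if w = z then p * (1 - p) * mean (\<lambda>x. \<phi> (eta e x)) else 0)"
    proof (cases "w = z")
      case True
      have "mean (\<lambda>x. \<phi> (eta e x) * (eta {w, anchor e} x)\<^sup>2) = p * (1 - p) * mean (\<lambda>x. \<phi> (eta e x))"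
      proof -
        have "(1 - p)\<^sup>2 * p + (- p)\<^sup>2 * (1 - p) = p * (1 - p)" by algebra
        then show ?thesis
          using mean_fun_eta[OF w'(1) ends(1)[OF assms] w'(2) \<phi>, of "\<lambda>y. y\<^sup>2"] by (simp only:)
      qed
      then show ?thesis using True by (simp only: power2_eq_square insert_commute simp_thms if_True)
    next
      case False
      have "free_of w (\<lambda>x. \<phi> (eta e x) * eta {anchor e, z} x)"
        using False w' \<phi> by (intro free_of_mult free_of_eta) auto
      from mean_eta_zero[OF w'(1) ends(1)[OF assms] w'(2) this] show ?thesis
        using False by (simp add: insert_commute mult_ac)
    qed
  qed
  also have "\<dots> = p * (1 - p) * mean (\<lambda>x. \<phi> (eta e x)) * real (card ?N)"
    using finite_nbrs by simp
  finally show ?thesis .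
qed

text \<open>This \<open>k\<close> minimises the left-hand side, whose dependence on \<open>k\<close>
  is \<open>p * (1 - p) * (4 * k^2 - 2 * k * (1 - 2 * p))\<close>. The term linear in
  \<open>R e\<close> has mean 0, and the mean \<open>2 * p * (1 - p)\<close> of
  \<open>\<bar>eta e x\<bar>\<close> enters the term quadratic in \<open>R e\<close>.\<close>

lemma mean_edge_error:
  assumes "e \<in> E"
  defines "k \<equiv> (1 - 2 * p) / 4"
  shows "mean (\<lambda>x. \<bar>eta e x\<bar> * ((eta e x + R e x - k)\<^sup>2 + k\<^sup>2)) =
    p * (1 - p) * (1 / 2 + (1 - 2 * p)\<^sup>2 / 4) + 2 * (p * (1 - p))\<^sup>2 * real (card (nbrs (anchor e) - {other e}))"
proof -
  have ev: "mean (\<lambda>x. \<phi> (eta e x)) = \<phi> (1 - p) * p + \<phi> (- p) * (1 - p)" for \<phi> :: "real \<Rightarrow> real"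
    using mean_fun_eta[OF ends(1-3)[OF assms(1)] free_of_const[of _ 1], of \<phi>] assms(1) by (simp add: edge_eq)
  have "mean (\<lambda>x. \<bar>eta e x\<bar> * ((eta e x + R e x - k)\<^sup>2 + k\<^sup>2)) =
      mean (\<lambda>x. \<bar>eta e x\<bar> * ((eta e x - k)\<^sup>2 + k\<^sup>2) + (2 * \<bar>eta e x\<bar> * (eta e x - k)) * R e x + \<bar>eta e x\<bar> * (R e x)\<^sup>2)"
    by (rule mean_cong) (simp add: power2_eq_square algebra_simps)
  also have "\<dots> = mean (\<lambda>x. \<bar>eta e x\<bar> * ((eta e x - k)\<^sup>2 + k\<^sup>2)) + mean (\<lambda>x. \<bar>eta e x\<bar> * (R e x)\<^sup>2)"
    using mean_eta_R[OF assms(1), of "\<lambda>y. 2 * \<bar>y\<bar> * (y - k)"] by (simp only: mean_add)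
  also have "mean (\<lambda>x. \<bar>eta e x\<bar> * (R e x)\<^sup>2) = p * (1 - p) * (2 * p * (1 - p)) * real (card (nbrs (anchor e) - {other e}))"
    using mean_eta_R_sq[OF assms(1), of abs] ev[of abs] p_pos p_less by simp
  also have "mean (\<lambda>x. \<bar>eta e x\<bar> * ((eta e x - k)\<^sup>2 + k\<^sup>2)) = p * (1 - p) * (1 / 2 + (1 - 2 * p)\<^sup>2 / 4)"
    using ev[of "\<lambda>y. \<bar>y\<bar> * ((y - k)\<^sup>2 + k\<^sup>2)"] p_pos p_less by (simp add: k_def power2_eq_square field_simps)
  finally show ?thesis by (simp add: power2_eq_square)
qed

lemma cherry_sum_eq: "cherry_sum x = (\<Sum>e\<in>E. eta e x * R e x)"
proof -
  have "cherry_sum x = (\<Sum>e\<in>E. \<Sum>w\<in>nbrs (anchor e) - {other e}. cherry (anchor e) {other e, w} x)"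
    unfolding cherry_sum_def cherries_def using finite_E finite_nbrs by (subst sum.Sigma) auto
  also have "\<dots> = (\<Sum>e\<in>E. eta e x * R e x)"
    unfolding R_def sum_distrib_left by (intro sum.cong refl) (auto simp: cherry_pair edge_eq)
  finally show ?thesis .
qed

text \<open>As \<open>eta\<close> takes the values \<open>1 - p\<close> and \<open>- p\<close>, its
  square is \<open>p * (1 - p) + (1 - 2 * p) * eta\<close>; subtracting \<open>k * eta\<close>
  leaves the coefficient \<open>3 / 4\<close>. The constants add up to
  \<open>sigma^2\<close>.\<close>

lemma linear_part:
  defines "k \<equiv> (1 - 2 * p) / 4"
  shows "(\<Sum>e\<in>E. eta e x * (eta e x + R e x - k)) / sigma\<^sup>2 =
    1 + 3 / 4 * (1 - 2 * p) / sigma * W x + cherry_sum x / sigma\<^sup>2"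
proof -
  have "eta e x * (eta e x + R e x - k) = p * (1 - p) + 3 / 4 * (1 - 2 * p) * eta e x + eta e x * R e x" for e
    using eta_cases[of e x] by (elim disjE) (simp_all only:, simp_all add: k_def field_simps)
  then have "(\<Sum>e\<in>E. eta e x * (eta e x + R e x - k)) = sigma\<^sup>2 + 3 / 4 * (1 - 2 * p) * (\<Sum>e\<in>E. eta e x) + cherry_sum x"
    by (simp only: sum.distrib sigma_sq cherry_sum_eq flip: sum_distrib_left) simp
  then show ?thesis
    using sigma_pos by (simp add: W_def add_divide_distrib power2_eq_square)
qed

text \<open>By Stein's equation the difference of means is that of \<open>g (W x)\<close> and
  \<open>W x * f (W x)\<close>. Fact \<open>A\<close> replaces the latter by \<open>lin x\<close> at
  the cost of the Taylor errors; fact \<open>B\<close> compares \<open>lin x\<close> with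
  \<open>g (W x)\<close>, since by \<open>linear_part\<close> the factor of \<open>g\<close> is 1 up
  to a multiple of \<open>W\<close> and the scaled cherry sum.\<close>

lemma stein_bound_smooth:
  fixes h h' :: "real \<Rightarrow> real"
  assumes "\<And>x. (h has_real_derivative h' x) (at x)" and "\<And>x. \<bar>h' x\<bar> \<le> 1"
  shows "\<bar>mean (\<lambda>x. h (W x)) - gauss_mean h\<bar> \<le>
    23 / 25 * (3 / 4 * (1 - 2 * p) / sigma + sqrt (mean (\<lambda>x. (cherry_sum x)\<^sup>2)) / sigma\<^sup>2) +
    (1 / 2 + (1 - 2 * p)\<^sup>2 / 4) / sigma + 2 * p * (1 - p) * real (card cherries) / (sigma * real m)"
proof -
  obtain f g where f: "\<And>x. (f has_real_derivative g x) (at x)"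
    and stein: "\<And>x. g x - x * f x = h x - gauss_mean h"
    and g: "\<And>x. \<bar>g x\<bar> \<le> 23 / 25" "2-lipschitz_on UNIV g"
    using stein_solution[OF assms] by blast
  define k where "k = (1 - 2 * p) / 4"
  define err where "err e x = \<bar>eta e x\<bar> * ((eta e x + R e x - k)\<^sup>2 + k\<^sup>2) / sigma ^ 3" for e x
  define lin where "lin x = g (W x) * ((\<Sum>e\<in>E. eta e x * (eta e x + R e x - k)) / sigma\<^sup>2)" for x
  have edge: "\<bar>eta e x / sigma * (f (W x) - f (W x - D e x) - k / sigma * g (W x - D e x)) -
      g (W x) * (eta e x * (eta e x + R e x - k) / sigma\<^sup>2)\<bar> \<le> err e x" if "e \<in> E" for e x
  proof -
    define d where "d = D e x"
    define w where "w = W x"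
    define j where "j = k / sigma"
    have dj: "d - j = (eta e x + R e x - k) / sigma"
      by (simp add: d_def j_def D_eq[OF that] diff_divide_distrib)
    \<comment> \<open>Both expansions are evaluated at the intermediate point
      \<open>w - (d - j)\<close>, one around \<open>w\<close> and one around \<open>w - d\<close>;
      subtracting them eliminates the value of \<open>f\<close> there.\<close>
    have "\<bar>f (w - (d - j)) - f w - (j - d) * g w\<bar> \<le> (d - j)\<^sup>2"
      using taylor_lipschitz_derivative[OF f g(2), of "w - (d - j)" w] by (simp add: power2_commute)
    moreover have "\<bar>f (w - (d - j)) - f (w - d) - j * g (w - d)\<bar> \<le> j\<^sup>2"
      using taylor_lipschitz_derivative[OF f g(2), of "w - (d - j)" "w - d"] by simp
    moreover have "(d - j) * g w = - ((j - d) * g w)" by algebra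
    ultimately have *: "\<bar>f w - f (w - d) - j * g (w - d) - (d - j) * g w\<bar> \<le> (d - j)\<^sup>2 + j\<^sup>2"
      by linarith
    have "eta e x / sigma * (f w - f (w - d) - j * g (w - d)) - g w * (eta e x / sigma * (d - j)) =
        eta e x / sigma * (f w - f (w - d) - j * g (w - d) - (d - j) * g w)"
      by algebra
    also have "\<bar>\<dots>\<bar> = \<bar>eta e x\<bar> / sigma * \<bar>f w - f (w - d) - j * g (w - d) - (d - j) * g w\<bar>"
      using sigma_pos by (simp only: abs_mult abs_divide abs_of_pos)
    also have "\<dots> \<le> \<bar>eta e x\<bar> / sigma * ((d - j)\<^sup>2 + j\<^sup>2)"
      using sigma_pos * by (intro mult_left_mono) auto
    also have "\<dots> = err e x"
      by (simp only: err_def dj) (simp add: j_def power_divide power2_eq_square power3_eq_cube add_divide_distrib[symmetric])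
    finally show ?thesis
      unfolding dj by (simp add: d_def w_def j_def power2_eq_square)
  qed
  have "mean (\<lambda>x. W x * f (W x)) = (\<Sum>e\<in>E. mean (\<lambda>x. eta e x / sigma * f (W x)))"
    by (simp add: W_def sum_distrib_right sum_divide_distrib mean_sum[symmetric])
  also have "\<dots> = (\<Sum>e\<in>E. mean (\<lambda>x. eta e x / sigma * (f (W x) - f (W x - D e x) - k / sigma * g (W x - D e x))))"
  proof (intro sum.cong refl)
    fix e assume e: "e \<in> E"
    \<comment> \<open>The inserted terms are functions of \<open>W x - D e x\<close>, hence
      uncorrelated with \<open>eta e\<close>.\<close>
    have "mean (\<lambda>x. eta e x / sigma * (f (W x) - f (W x - D e x) - k / sigma * g (W x - D e x))) =
        mean (\<lambda>x. eta e x / sigma * f (W x) - (1 / sigma) * (eta e x * (f (W x - D e x) + k / sigma * g (W x - D e x))))"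
      by (rule mean_cong) (simp add: algebra_simps)
    also have "\<dots> = mean (\<lambda>x. eta e x / sigma * f (W x))"
      using mean_eta_W_minus_D[OF e, of "\<lambda>y. f y + k / sigma * g y"] by (simp only: mean_diff mean_cmult mult_zero_right diff_zero)
    finally show "mean (\<lambda>x. eta e x / sigma * f (W x)) =
      mean (\<lambda>x. eta e x / sigma * (f (W x) - f (W x - D e x) - k / sigma * g (W x - D e x)))" ..
  qed
  finally have Wf: "mean (\<lambda>x. W x * f (W x)) =
    mean (\<lambda>x. \<Sum>e\<in>E. eta e x / sigma * (f (W x) - f (W x - D e x) - k / sigma * g (W x - D e x)))"
    by (simp add: mean_sum)
  have "\<bar>mean (\<lambda>x. W x * f (W x)) - mean lin\<bar> \<le> mean (\<lambda>x. \<Sum>e\<in>E. err e x)"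
    unfolding Wf mean_diff[symmetric]
  proof (rule order_trans[OF mean_abs mean_mono])
    fix x
    show "\<bar>(\<Sum>e\<in>E. eta e x / sigma * (f (W x) - f (W x - D e x) - k / sigma * g (W x - D e x))) - lin x\<bar> \<le> (\<Sum>e\<in>E. err e x)"
      unfolding lin_def sum_divide_distrib sum_distrib_left sum_subtractf[symmetric]
      by (rule order_trans[OF sum_abs sum_mono]) (rule edge)
  qed
  also have "\<dots> = (\<Sum>e\<in>E. p * (1 - p) * (1 / 2 + (1 - 2 * p)\<^sup>2 / 4) + 2 * (p * (1 - p))\<^sup>2 * real (card (nbrs (anchor e) - {other e}))) / sigma ^ 3"
    unfolding mean_sum sum_divide_distrib err_def mean_divide k_def by (intro sum.cong refl) (simp only: mean_edge_error)
  \<comment> \<open>Summed over the edges, the numbers of further neighbours of the anchors give the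
    number of cherries.\<close>
  also have "\<dots> = (real m * (p * (1 - p)) * (1 / 2 + (1 - 2 * p)\<^sup>2 / 4) + 2 * (p * (1 - p))\<^sup>2 * real (card cherries)) / sigma ^ 3"
    using finite_E finite_nbrs by (simp add: sum.distrib sum_distrib_left cherries_def card_SigmaI)
  also have "\<dots> = (1 / 2 + (1 - 2 * p)\<^sup>2 / 4) / sigma + 2 * p * (1 - p) * real (card cherries) / (sigma * real m)"
  proof -
    have s3: "sigma ^ 3 = sigma * (real m * (p * (1 - p)))"
      by (simp add: power3_eq_cube sigma_sq[symmetric] power2_eq_square)
    have ne: "real m \<noteq> 0" "p \<noteq> 0" "1 - p \<noteq> 0" "sigma \<noteq> 0" using m_pos p_pos p_less sigma_pos by auto
    have "(a * b + 2 * y\<^sup>2 * n) / (s * a) = b / s + 2 * y * n / (s * M)"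
      if "a = M * y" "a \<noteq> 0" "s \<noteq> 0" for a b y n s M :: real
      using that by (auto simp: field_simps power2_eq_square)
    from this[of "real m * (p * (1 - p))" "real m" "p * (1 - p)" sigma] show ?thesis
      unfolding s3 using ne by (simp add: mult.assoc)
  qed
  finally have A: "\<bar>mean (\<lambda>x. W x * f (W x)) - mean lin\<bar> \<le> \<dots>" .
  have "\<bar>mean lin - mean (\<lambda>x. g (W x))\<bar> \<le> mean (\<lambda>x. 23 / 25 * (3 / 4 * (1 - 2 * p) / sigma * \<bar>W x\<bar> + \<bar>cherry_sum x\<bar> / sigma\<^sup>2))"
    unfolding mean_diff[symmetric]
  proof (rule order_trans[OF mean_abs mean_mono])
    fix x
    have "lin x - g (W x) = g (W x) * (3 / 4 * (1 - 2 * p) / sigma * W x + cherry_sum x / sigma\<^sup>2)"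
      unfolding lin_def k_def linear_part by (simp add: algebra_simps)
    also have "\<bar>\<dots>\<bar> \<le> 23 / 25 * \<bar>3 / 4 * (1 - 2 * p) / sigma * W x + cherry_sum x / sigma\<^sup>2\<bar>"
      unfolding abs_mult by (intro mult_right_mono g) auto
    also have "\<dots> \<le> 23 / 25 * (\<bar>3 / 4 * (1 - 2 * p) / sigma * W x\<bar> + \<bar>cherry_sum x / sigma\<^sup>2\<bar>)"
      by (intro mult_left_mono abs_triangle_ineq) auto
    also have "\<bar>3 / 4 * (1 - 2 * p) / sigma * W x\<bar> = 3 / 4 * (1 - 2 * p) / sigma * \<bar>W x\<bar>"
      using p_le sigma_pos by (simp add: abs_mult)
    also have "\<bar>cherry_sum x / sigma\<^sup>2\<bar> = \<bar>cherry_sum x\<bar> / sigma\<^sup>2"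
      by simp
    finally show "\<bar>lin x - g (W x)\<bar> \<le> 23 / 25 * (3 / 4 * (1 - 2 * p) / sigma * \<bar>W x\<bar> + \<bar>cherry_sum x\<bar> / sigma\<^sup>2)" .
  qed
  also have "\<dots> = 23 / 25 * (3 / 4 * (1 - 2 * p) / sigma * mean (\<lambda>x. \<bar>W x\<bar>) + mean (\<lambda>x. \<bar>cherry_sum x\<bar>) / sigma\<^sup>2)"
    by (simp only: mean_cmult mean_add mean_divide)
  also have "\<dots> \<le> 23 / 25 * (3 / 4 * (1 - 2 * p) / sigma * 1 + sqrt (mean (\<lambda>x. (cherry_sum x)\<^sup>2)) / sigma\<^sup>2)"
    using p_le sigma_pos
    by (intro mult_left_mono add_mono divide_right_mono mean_abs_W mean_abs_le_sqrt) auto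
  finally have B: "\<bar>mean lin - mean (\<lambda>x. g (W x))\<bar> \<le> 23 / 25 * (3 / 4 * (1 - 2 * p) / sigma + sqrt (mean (\<lambda>x. (cherry_sum x)\<^sup>2)) / sigma\<^sup>2)"
    by simp
  have "mean (\<lambda>x. h (W x)) - gauss_mean h = mean (\<lambda>x. h (W x) - gauss_mean h)"
    by (simp add: mean_diff)
  also have "\<dots> = mean (\<lambda>x. g (W x)) - mean (\<lambda>x. W x * f (W x))"
    by (simp add: stein[symmetric] mean_diff)
  finally show ?thesis using A B by linarith
qed

text \<open>A Lipschitz function need not be differentiable everywhere; a smoothed one within
  \<open>\<epsilon> / 2\<close> of it changes each of the two means by at most
  \<open>\<epsilon> / 2\<close>.\<close>

lemma stein_bound_lipschitz:
  assumes h: "1-lipschitz_on UNIV h"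
  shows "\<bar>mean (\<lambda>x. h (W x)) - gauss_mean h\<bar> \<le>
    23 / 25 * (3 / 4 * (1 - 2 * p) / sigma + sqrt (mean (\<lambda>x. (cherry_sum x)\<^sup>2)) / sigma\<^sup>2) +
    (1 / 2 + (1 - 2 * p)\<^sup>2 / 4) / sigma + 2 * p * (1 - p) * real (card cherries) / (sigma * real m)"
    (is "_ \<le> ?B")
proof (rule field_le_epsilon)
  fix \<epsilon> :: real assume "\<epsilon> > 0"
  then have "\<epsilon> / 2 > 0" by simp
  from lipschitz_mollification[OF h this] obtain u u' where
    u: "\<And>x. (u has_real_derivative u' x) (at x)" "\<And>x. \<bar>u' x\<bar> \<le> 1" "\<And>x. \<bar>u x - h x\<bar> \<le> \<epsilon> / 2"
    by blast
  have "\<bar>mean (\<lambda>x. u (W x)) - mean (\<lambda>x. h (W x))\<bar> \<le> mean (\<lambda>_. \<epsilon> / 2)"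
    unfolding mean_diff[symmetric] by (rule order_trans[OF mean_abs mean_mono]) (rule u)
  moreover have "\<bar>gauss_mean u - gauss_mean h\<bar> \<le> \<epsilon> / 2"
    using lipschitz_of_deriv[OF u(1,2)] h u(3) by (rule gauss_mean_close)
  ultimately show "\<bar>mean (\<lambda>x. h (W x)) - gauss_mean h\<bar> \<le> ?B + \<epsilon>"
    using stein_bound_smooth[OF u(1,2)] unfolding mean_const by linarith
qed

section \<open>Numerical estimates of the error terms\<close>

lemma inverse_sigma: "1 / sigma = sqrt (real c / real m) / sqrt (1 - p)"
  using m_pos c_ge_2 by (simp add: sigma_def p_def real_sqrt_mult real_sqrt_divide)

text \<open>With \<open>r = 1 - 2 * p\<close> and \<open>r^2 \<le> r\<close> the coefficient of
  \<open>1 / sigma\<close> is at most \<open>1 / 2 + 0.94 * r \<le> 3 / 2 * (1 - p)\<close>, and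
  \<open>1 - p \<le> sqrt (1 - p)\<close> cancels the denominator in
  \<open>inverse_sigma\<close>.\<close>

lemma diagonal_bound:
  "(1 / 2 + (1 - 2 * p)\<^sup>2 / 4) / sigma + 23 / 25 * (3 / 4 * (1 - 2 * p) / sigma) \<le> 3 / 2 * sqrt (real c / real m)"
proof -
  define r where "r = 1 - 2 * p"
  have r: "0 \<le> r" "r \<le> 1" using p_pos p_le by (auto simp: r_def)
  have "r\<^sup>2 \<le> r" using r by (simp add: power2_eq_square mult_left_le)
  moreover have "1 / 2 + y / 4 + 23 / 25 * (3 / 4 * r) \<le> 3 / 2 * ((1 + r) / 2)" if "y \<le> r" for y
    using r that by (simp add: field_simps)
  ultimately have "1 / 2 + r\<^sup>2 / 4 + 23 / 25 * (3 / 4 * r) \<le> 3 / 2 * ((1 + r) / 2)" by blast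
  also have "(1 + r) / 2 = 1 - p" by (simp add: r_def)
  also have "1 - p \<le> sqrt (1 - p)"
    using p_pos p_less by (intro real_le_rsqrt) (simp add: power2_eq_square mult_left_le)
  finally have "(1 / 2 + r\<^sup>2 / 4) + 23 / 25 * (3 / 4 * r) \<le> 3 / 2 * sqrt (1 - p)" by simp
  then have "((1 / 2 + r\<^sup>2 / 4) + 23 / 25 * (3 / 4 * r)) * (1 / sigma) \<le> 3 / 2 * sqrt (1 - p) * (1 / sigma)"
    using sigma_pos by (intro mult_right_mono) auto
  also have "\<dots> = 3 / 2 * sqrt (real c / real m)"
    using p_less by (simp add: inverse_sigma)
  finally show ?thesis by (simp add: r_def add_divide_distrib distrib_right)
qed

text \<open>The bound on the number of cherries cancels the powers of \<open>m\<close>. This part of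
  the Taylor error takes \<open>2 * sqrt 2\<close> of the final constant
  \<open>5 * sqrt 2\<close>.\<close>

lemma off_diagonal_bound:
  "2 * p * (1 - p) * real (card cherries) / (sigma * real m) \<le> 2 * sqrt 2 * sqrt p"
proof -
  have "2 * p * (1 - p) * real (card cherries) / (sigma * real m) \<le>
      2 * p * (1 - p) * (sqrt 2 * real m * sqrt (real m)) / (sigma * real m)"
    using p_pos p_less sigma_pos m_pos card_cherries by (intro divide_right_mono mult_left_mono) auto
  also have "\<dots> = 2 * sqrt 2 * (p * (1 - p) / sqrt (p * (1 - p)))"
    using m_pos by (simp add: sigma_def real_sqrt_mult)
  also have "\<dots> = 2 * sqrt 2 * sqrt (p * (1 - p))"
    using p_pos p_less by (subst real_div_sqrt) auto
  also have "\<dots> \<le> 2 * sqrt 2 * sqrt p"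
    using p_pos p_less by (intro mult_left_mono) (auto simp: mult_left_le)
  finally show ?thesis .
qed

text \<open>Division by \<open>sigma^4 = m^2 * p^2 * (1 - p)^2\<close> separates the two kinds of
  pairs: equal supports give the term in \<open>m\<close>, equal leaves give
  \<open>3 * p / (1 - p)\<close>, at most \<open>6 * p\<close> as
  \<open>p \<le> 1 / 2\<close>.\<close>

lemma cherry_bound:
  "sqrt (mean (\<lambda>x. (cherry_sum x)\<^sup>2)) / sigma\<^sup>2 \<le> sqrt (3 * sqrt 2 / sqrt (real m)) + sqrt (6 * p)"
proof -
  have "mean (\<lambda>x. (cherry_sum x)\<^sup>2) / (sigma\<^sup>2)\<^sup>2 \<le>
      (p\<^sup>2 * (1 - p)\<^sup>2 * (3 * (sqrt 2 * real m * sqrt (real m))) + p ^ 3 * (1 - p) * (3 * (real m)\<^sup>2)) / (sigma\<^sup>2)\<^sup>2"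
    using card_cherries p_pos p_less
    by (intro divide_right_mono order_trans[OF mean_cherry_sum_sq] add_mono mult_left_mono) auto
  also have "\<dots> = 3 * sqrt 2 * (sqrt (real m) / real m) + 3 * p / (1 - p)"
  proof -
    have "(P\<^sup>2 * Q\<^sup>2 * (3 * (S * M * T)) + P ^ 3 * Q * (3 * M\<^sup>2)) / (M * (P * Q))\<^sup>2 = 3 * S * (T / M) + 3 * P / Q"
      if "P \<noteq> 0" "Q \<noteq> 0" "M \<noteq> 0" for P Q M S T :: real
      using that by (simp add: field_simps power2_eq_square power3_eq_cube)
    then show ?thesis
      unfolding sigma_sq using m_pos p_pos p_less by simp
  qed
  also have "sqrt (real m) / real m = 1 / sqrt (real m)"
    using m_pos by (simp add: field_simps)
  also have "3 * p / (1 - p) \<le> 3 * p / (1 / 2)"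
    using p_pos p_le by (intro divide_left_mono) auto
  finally have "mean (\<lambda>x. (cherry_sum x)\<^sup>2) / (sigma\<^sup>2)\<^sup>2 \<le> 3 * sqrt 2 / sqrt (real m) + 6 * p" by simp
  then have "sqrt (mean (\<lambda>x. (cherry_sum x)\<^sup>2) / (sigma\<^sup>2)\<^sup>2) \<le> sqrt (3 * sqrt 2 / sqrt (real m) + 6 * p)"
    by simp
  also have "\<dots> \<le> sqrt (3 * sqrt 2 / sqrt (real m)) + sqrt (6 * p)"
    using p_pos by (intro sqrt_add_le_add_sqrt) auto
  finally show ?thesis
    by (simp only: real_sqrt_divide[of _ "(sigma\<^sup>2)\<^sup>2"] real_sqrt_abs abs_power2)
qed

proposition normal_approximation:
  assumes "1-lipschitz_on UNIV h"
  shows "\<bar>mean (\<lambda>x. h (W x)) - gauss_mean h\<bar> \<le> 3 / 2 * sqrt (real c / real m) + 5 * sqrt 2 / sqrt (real c)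
    + 1 / sqrt pi * (2 powr (7 / 4) / real m powr (1 / 4))"
proof -
  have "23 / 25 * (sqrt (mean (\<lambda>x. (cherry_sum x)\<^sup>2)) / sigma\<^sup>2) \<le>
      23 / 25 * (sqrt (3 * sqrt 2 / sqrt (real m)) + sqrt (6 * p))"
    by (intro mult_left_mono cherry_bound) auto
  \<comment> \<open>The 4-cycles may use the \<open>3 * sqrt 2\<close> that
    \<open>off_diagonal_bound\<close> leaves of \<open>5 * sqrt 2\<close>.\<close>
  moreover have "sqrt 6 \<le> 3 * sqrt 2" by (rule real_le_lsqrt) (simp_all add: power_mult_distrib)
  then have "23 / 25 * sqrt 6 \<le> 3 * sqrt 2" using real_sqrt_ge_zero[of 6] by linarith
  then have "23 / 25 * sqrt 6 * sqrt p \<le> 3 * sqrt 2 * sqrt p" using p_pos by (intro mult_right_mono) auto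
  then have "23 / 25 * sqrt (6 * p) \<le> 3 * sqrt 2 * sqrt p" by (simp add: real_sqrt_mult)
  moreover have "5 * sqrt 2 / sqrt (real c) = 5 * sqrt 2 * sqrt p"
    by (simp add: p_def real_sqrt_divide)
  ultimately show ?thesis
    using stein_bound_lipschitz[OF assms] diagonal_bound off_diagonal_bound quarter_power_bound[OF m_pos]
    unfolding distrib_left by linarith
qed

text \<open>The colouring taken from the probability space is restricted to \<open>V\<close>;
  agreement on \<open>V\<close> suffices because every edge is a subset of \<open>V\<close>.\<close>

lemma W_eq_mono_edges:
  assumes "\<And>v. v \<in> V \<Longrightarrow> x v = f v"
  shows "W x = (real (card (mono_edges E f)) - real m / real c) / sqrt (real m / real c * (1 - 1 / real c))"
proof -
  have "(\<Sum>e\<in>E. eta e x) = (\<Sum>e\<in>E. (if \<forall>u\<in>e. \<forall>w\<in>e. f u = f w then 1 else 0) - p)"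
  proof (intro sum.cong refl)
    fix e assume "e \<in> E"
    then have "e \<subseteq> V" using edges by (auto simp: nsets_def)
    then have "(\<forall>u\<in>e. \<forall>w\<in>e. x u = x w) \<longleftrightarrow> (\<forall>u\<in>e. \<forall>w\<in>e. f u = f w)"
      using assms by (metis subsetD)
    then show "eta e x = (if \<forall>u\<in>e. \<forall>w\<in>e. f u = f w then 1 else 0) - p" by (simp only: eta_def)
  qed
  also have "\<dots> = real (card (mono_edges E f)) - real m * p"
    using finite_E by (simp add: sum_subtractf sum.If_cases mono_edges_def Int_def)
  finally show ?thesis by (simp add: W_def sigma_def p_def)
qed

end

section \<open>Transfer to an arbitrary probability space\<close>

theorem theorem1p1:
  fixes V :: "'v set" and E :: "'v set set" and m c :: nat
    and M :: "'w measure" and color :: "'v \<Rightarrow> 'w \<Rightarrow> nat"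
    and Y W :: "'w \<Rightarrow> real"
  assumes graph: "fin_simple_graph V E"
    and m: "card E = m" "m \<ge> 1"
    and c: "c \<ge> 2"
    and prob: "prob_space M"
    and indep: "prob_space.indep_vars M (\<lambda>_. count_space {..<c}) color V"
    and unif: "\<And>v. v \<in> V \<Longrightarrow>
      distr M (count_space {..<c}) (color v) = uniform_count_measure {..<c}"
    and Y: "\<And>\<omega>. Y \<omega> = real (card (mono_edges E (\<lambda>v. color v \<omega>)))"
    and W: "\<And>\<omega>. W \<omega> =
      (Y \<omega> - real m / real c) / sqrt (real m / real c * (1 - 1 / real c))"
  shows "wasserstein_dist (distr M borel W) std_normal_distribution
    \<le> ereal (3 / 2 * sqrt (real c / real m) + 5 * sqrt 2 / sqrt (real c)
        + 1 / sqrt pi * (2 powr (7 / 4) / real m powr (1 / 4)))"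
proof -
  have "E \<noteq> {}" using m by auto
  interpret G: coloured_graph V c E
    using graph c \<open>E \<noteq> {}\<close> by unfold_locales (auto simp: fin_simple_graph_def)
  have "V \<noteq> {}"
    using \<open>E \<noteq> {}\<close> G.ends(1) by blast
  note transfer = G.colouring_expectation[OF prob \<open>V \<noteq> {}\<close> indep unif]
  have W_eq: "W = (\<lambda>\<omega>. G.W (\<lambda>v\<in>V. color v \<omega>))"
    by (rule ext, subst G.W_eq_mono_edges[where f = "\<lambda>v. color v _"]) (auto simp: W Y m)
  have measW: "W \<in> borel_measurable M"
    unfolding W_eq by (rule transfer)
  show ?thesis
    unfolding wasserstein_dist_def
  proof (rule SUP_least, clarsimp simp only: mem_Collect_eq ereal_less_eq)
    fix h :: "real \<Rightarrow> real" assume h: "1-lipschitz_on UNIV h"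
    have meas: "h \<in> borel_measurable borel"
      using lipschitz_continuous_real[OF h] by (rule borel_measurable_continuous_onI)
    \<comment> \<open>Both integrals are rewritten: the one for the law of \<open>W\<close> as an
      average over colourings, the one for the normal distribution as an integral against its
      density.\<close>
    have "(LINT x|distr M borel W. h x) = G.mean (\<lambda>x. h (G.W x))"
      using measW meas by (subst integral_distr) (auto simp: W_eq transfer(2)[where F = "\<lambda>x. h (G.W x)"])
    moreover have "(LINT x|std_normal_distribution. h x) = gauss_mean h"
      using meas by (subst integral_density) (auto simp: gauss_mean_def)
    ultimately show "\<bar>(LINT x|distr M borel W. h x) - (LINT x|std_normal_distribution. h x)\<bar> \<le>
      3 / 2 * sqrt (real c / real m) + 5 * sqrt 2 / sqrt (real c) + 1 / sqrt pi * (2 powr (7 / 4) / real m powr (1 / 4))"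
      using G.normal_approximation[OF h] by (simp only: m(1))
  qed
qed

end
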